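(* Let $\Omega=(0,1)\times\mathbb{R}$ and let $b\in L^\infty(\Omega)$ be $1$-periodic in $t$ with $b(s,t)\ge0$ for almost all $(s,t)\in\Omega$. Let $X=L^2(0,1)$ and consider the transport equation $$z_t(s,t)=z_s(s,t)-b(s,t)z(s,t),\quad (s,t)\in(0,1)\times(0,\infty),$$ with periodic boundary condition $z(0,t)=z(1,t)$, $t>0$, and initial condition $z(s,0)=x(s)$, $s\in(0,1)$, where $x\in X$. Let $$a(s)=\int_0^1b(s-r,r)\,dr,\quad s\in(0,1),$$ and, modulo null sets, $I_a=\{s\in(0,1):a(s)>0\}$ and $J_a=\{s\in(0,1):a(s)=0\}$. Then the following hold. (i) For any initial value $x\in X$ the solution $z\colon\mathbb{R}_+\to X$ satisfies $$\|z(t)-(\mathbf{1}_{J_a}x)(\cdot+t)\|\to0,\quad t\to\infty.$$ In particular, the system is asymptotically periodic and it is stable if and only if $J_a$ is a null set. (ii) There exist $M,\beta>0$ such that $$\|z(t)-(\mathbf{1}_{J_a}x)(\cdot+t)\|\le Me^{-\beta t}\|x\|,\quad t\ge0,\ x\in X,$$ if and only if $a(s)\ge c$ for almost all $s\in I_a$ and some $c>0$. (iii) In any case, if $x\in X$ is such that $a^{-\gamma}\mathbf{1}_{I_a}x\in X$ for some $\gamma>0$, then $$\|z(t)-(\mathbf{1}_{J_a}x)(\cdot+t)\|=o(t^{-\gamma}),\quad t\to\infty.$$ (iv) If $x$ lies in the dense subspace of functions in $X$ satisfying $a^{-k}\mathbf{1}_{I_a}x\in X$ for all integers $k\ge1$,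 then the convergence in (i) is superpolynomially fast, that is, $\|z(t)-(\mathbf{1}_{J_a}x)(\cdot+t)\|=o(t^{-\gamma})$ as $t\to\infty$ for all $\gamma>0$.
   Context: Any function on $(0,1)$ is identified with its $1$-periodic extension to $\mathbb{R}$ (in particular $b$ is extended $1$-periodically in $s$). The function $a^{-\gamma}\mathbf{1}_{I_a}x$ is understood to be zero off $I_a$. The problem is viewed as $\dot z(t)=(A_0-B(t)B(t)^* )z(t)$, $z(0)=x$, on $X$, where $A_0x=x'$ with $D(A_0)=\{x\in H^1(0,1):x(0)=x(1)\}$ generates the unitary group $T_0(t)x=x(\cdot+t)$, and $B(t)x=b(\cdot,t)^{1/2}x$. The solution is the unique mild solution, namely the function satisfying $z(t)=T_0(t)x-\int_0^tT_0(t-r)B(r)B(r)^*z(r)\,dr$, $t\ge0$, which is given explicitly by $$z(s,t)=x(s+t)\exp\left(-\int_0^tb(s+t-r,r)\,dr\right),\quad (s,t)\in(0,1)\times(0,\infty).$$ The system is asymptotically periodic if for every $x\in X$ there is a periodic function $z_0\colon\mathbb{R}_+\to X$ with $\|z(t)-z_0(t)\|\to0$ as $t\to\infty$; it is stable if $\|z(t)\|\to0$ as $t\to\infty$ for every $x\in X$. *)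

theory Defs
  imports "HOL-Analysis.Analysis" "HOL-Library.Landau_Symbols"
begin

section \<open>The space of square-integrable functions on the unit interval\<close>

text \<open>
  Elements of the complex space \<open>X = L\<^sup>2(0,1)\<close> are represented by Borel functions (every class
  modulo null sets contains one). Only the values on the open unit interval matter, and equality
  in \<open>X\<close> is equality almost everywhere there.
\<close>

abbreviation unit_measure :: "real measure" where
  "unit_measure \<equiv> restrict_space lborel {0<..<1}"

definition L2_space :: "(real \<Rightarrow> complex) set" where
  "L2_space = {x \<in> borel_measurable unit_measure.
     integrable unit_measure (\<lambda>s. (cmod (x s))\<^sup>2)}"

definition L2_norm :: "(real \<Rightarrow> complex) \<Rightarrow> real" where
  "L2_norm x = sqrt (LINT s|unit_measure. (cmod (x s))\<^sup>2)"

definition L2_dist :: "(real \<Rightarrow> complex) \<Rightarrow> (real \<Rightarrow> complex) \<Rightarrow> real" where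
  "L2_dist x y = L2_norm (\<lambda>s. x s - y s)"

definition L2_dense_subspace :: "(real \<Rightarrow> complex) set \<Rightarrow> bool" where
  "L2_dense_subspace D \<longleftrightarrow>
     D \<subseteq> L2_space \<and>
     (\<lambda>s. 0) \<in> D \<and>
     (\<forall>x\<in>D. \<forall>y\<in>D. (\<lambda>s. x s + y s) \<in> D) \<and>
     (\<forall>x\<in>D. \<forall>c. (\<lambda>s. c * x s) \<in> D) \<and>
     (\<forall>y\<in>L2_space. \<forall>\<epsilon>>0. \<exists>x\<in>D. L2_dist x y < \<epsilon>)"

section \<open>Bochner integral of functions with values in the space\<close>

text \<open>
  The elements of \<open>X\<close> are functions rather than members of a Banach space type, so Bochner's
  definition is spelled out here. A list of pairs \<open>(E, v)\<close> stands for the simple function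
  \<open>\<Sum> 1\<^sub>E v\<close>, where each \<open>E\<close> is a measurable set of finite measure and \<open>v\<close> is in \<open>X\<close>.
\<close>

type_synonym L2_simple = "(real set \<times> (real \<Rightarrow> complex)) list"

definition is_simple :: "L2_simple \<Rightarrow> bool" where
  "is_simple L \<longleftrightarrow>
     (\<forall>(E, v) \<in> set L. E \<in> sets lborel \<and> emeasure lborel E < \<infinity> \<and> v \<in> L2_space)"

definition simple_val :: "L2_simple \<Rightarrow> real \<Rightarrow> real \<Rightarrow> complex" where
  "simple_val L r = (\<lambda>s. \<Sum>(E, v)\<leftarrow>L. indicator E r * v s)"

definition simple_int :: "real set \<Rightarrow> L2_simple \<Rightarrow> real \<Rightarrow> complex" where
  "simple_int A L = (\<lambda>s. \<Sum>(E, v)\<leftarrow>L. complex_of_real (measure lborel (E \<inter> A)) * v s)"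

text \<open>\<open>y\<close> is the integral of \<open>f\<close> over the Borel set \<open>A\<close>.\<close>

definition has_L2_bochner_integral ::
    "real set \<Rightarrow> (real \<Rightarrow> real \<Rightarrow> complex) \<Rightarrow> (real \<Rightarrow> complex) \<Rightarrow> bool" where
  "has_L2_bochner_integral A f y \<longleftrightarrow>
     y \<in> L2_space \<and>
     (AE r in lborel. r \<in> A \<longrightarrow> f r \<in> L2_space) \<and>
     (\<exists>L :: nat \<Rightarrow> L2_simple.
        (\<forall>n. is_simple (L n)) \<and>
        (\<forall>n. set_integrable lborel A (\<lambda>r. L2_dist (f r) (simple_val (L n) r))) \<and>
        (\<lambda>n. LINT r:A|lborel. L2_dist (f r) (simple_val (L n) r)) \<longlonglongrightarrow> 0 \<and>
        (\<lambda>n. L2_dist (simple_int A (L n)) y) \<longlonglongrightarrow> 0)"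

section \<open>The transport equation\<close>

text \<open>
  The 1-periodic extension of a function on the open unit interval. Its value at the integers,
  which form a null set, is set to 0.
\<close>

definition per_ext :: "(real \<Rightarrow> 'a::zero) \<Rightarrow> real \<Rightarrow> 'a" where
  "per_ext f s = (if frac s = 0 then 0 else f (frac s))"

definition T0 :: "real \<Rightarrow> (real \<Rightarrow> complex) \<Rightarrow> real \<Rightarrow> complex" where
  "T0 t x = (\<lambda>s. per_ext x (s + t))"

definition B :: "(real \<Rightarrow> real \<Rightarrow> real) \<Rightarrow> real \<Rightarrow> (real \<Rightarrow> complex) \<Rightarrow> real \<Rightarrow> complex" where
  "B b t x = (\<lambda>s. complex_of_real (sqrt (b s t)) * x s)"

text \<open>
  Being multiplication by a real function, \<open>B b r\<close> is self-adjoint, so that \<open>B(r)B(r)\<^sup>*\<close>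
  is \<open>B b r \<circ> B b r\<close>.
\<close>

definition mild_solution ::
    "(real \<Rightarrow> real \<Rightarrow> real) \<Rightarrow> (real \<Rightarrow> complex) \<Rightarrow> (real \<Rightarrow> real \<Rightarrow> complex) \<Rightarrow> bool" where
  "mild_solution b x z \<longleftrightarrow>
     (\<forall>t\<ge>0. z t \<in> L2_space) \<and>
     (\<forall>t\<ge>0. ((\<lambda>r. L2_dist (z r) (z t)) \<longlongrightarrow> 0) (at t within {0..})) \<and>
     (\<forall>t\<ge>0. \<exists>y. has_L2_bochner_integral {0..t} (\<lambda>r. T0 (t - r) (B b r (B b r (z r)))) y \<and>
        (AE s in unit_measure. z t s = T0 t x s - y s))"

definition well_posed :: "(real \<Rightarrow> real \<Rightarrow> real) \<Rightarrow> bool" where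
  "well_posed b \<longleftrightarrow>
     (\<forall>x\<in>L2_space. \<exists>z. mild_solution b x z \<and>
        (\<forall>w. mild_solution b x w \<longrightarrow> (\<forall>t\<ge>0. AE s in unit_measure. w t s = z t s)))"

definition asymptotically_periodic :: "(real \<Rightarrow> real \<Rightarrow> real) \<Rightarrow> bool" where
  "asymptotically_periodic b \<longleftrightarrow>
     (\<forall>x\<in>L2_space. \<forall>z. mild_solution b x z \<longrightarrow>
        (\<exists>z0. (\<forall>t\<ge>0. z0 t \<in> L2_space) \<and>
              (\<exists>p>0. \<forall>t\<ge>0. AE s in unit_measure. z0 (t + p) s = z0 t s) \<and>
              ((\<lambda>t. L2_dist (z t) (z0 t)) \<longlongrightarrow> 0) at_top))"

definition is_stable :: "(real \<Rightarrow> real \<Rightarrow> real) \<Rightarrow> bool" where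
  "is_stable b \<longleftrightarrow>
     (\<forall>x\<in>L2_space. \<forall>z. mild_solution b x z \<longrightarrow> ((\<lambda>t. L2_norm (z t)) \<longlongrightarrow> 0) at_top)"

section \<open>The damping coefficient\<close>

abbreviation \<Omega>_measure :: "(real \<times> real) measure" where
  "\<Omega>_measure \<equiv> restrict_space lborel ({0<..<1} \<times> UNIV)"

text \<open>
  As for \<open>X\<close>, classes in \<open>L\<^sup>\<infinity>(\<Omega>)\<close> are represented by Borel functions, and accordingly
  periodicity in time is required only almost everywhere.
\<close>

definition Linfty :: "(real \<Rightarrow> real \<Rightarrow> real) \<Rightarrow> bool" where
  "Linfty b \<longleftrightarrow>
     (\<lambda>(s, t). b s t) \<in> borel_measurable \<Omega>_measure \<and>
     (\<exists>C. AE (s, t) in \<Omega>_measure. \<bar>b s t\<bar> \<le> C)"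

definition damping :: "(real \<Rightarrow> real \<Rightarrow> real) \<Rightarrow> real \<Rightarrow> real" where
  "damping b s = (LINT r:{0..1}|lborel. per_ext (\<lambda>\<sigma>. b \<sigma> r) (s - r))"

definition I_set :: "(real \<Rightarrow> real) \<Rightarrow> real set" where
  "I_set a = {s \<in> {0<..<1}. a s > 0}"

definition J_set :: "(real \<Rightarrow> real) \<Rightarrow> real set" where
  "J_set a = {s \<in> {0<..<1}. a s = 0}"

definition restrict_to :: "real set \<Rightarrow> (real \<Rightarrow> complex) \<Rightarrow> real \<Rightarrow> complex" where
  "restrict_to S x = (\<lambda>s. indicator S s * x s)"

text \<open>The function \<open>a\<^sup>-\<^sup>\<gamma> 1 x\<close>, with \<open>1\<close> the indicator of \<open>I_set a\<close>.\<close>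

definition weighted :: "(real \<Rightarrow> real) \<Rightarrow> real \<Rightarrow> (real \<Rightarrow> complex) \<Rightarrow> real \<Rightarrow> complex" where
  "weighted a \<gamma> x = (\<lambda>s. if s \<in> I_set a then complex_of_real (a s powr (-\<gamma>)) * x s else 0)"

definition rapid_subspace :: "(real \<Rightarrow> real) \<Rightarrow> (real \<Rightarrow> complex) set" where
  "rapid_subspace a = {x \<in> L2_space. \<forall>k::nat. k \<ge> 1 \<longrightarrow> weighted a (real k) x \<in> L2_space}"

end

theory Submission
  imports Defs "HOL-Real_Asymp.Real_Asymp"
begin

text \<open>
  The equation is solved along characteristics. A particle starting at \<open>s\<close> moves to \<open>s - t\<close> on the
  circle and its amplitude is multiplied by \<open>exp (- G t s)\<close>, where \<open>G t s\<close> is the damping it has met.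
  Since the particle returns to its starting point after one period, and the coefficient also has
  period one in time, each period contributes the same amount \<open>G 1 s = a s\<close>, so that
  \<open>(t - 1) a \<le> G t \<le> (t + 1) a\<close> (lemma \<open>G_linear_bounds\<close>). Undoing the rotation, which is
  an isometry, the distance between the solution and \<open>T0 t (1\<^sub>J x)\<close> is the norm of
  \<open>1\<^sub>I exp (- G t) x\<close> (lemma \<open>deviation_eq\<close>). The transport equation has thereby been
  reduced to a family of multiplication operators, comparable to \<open>1\<^sub>I exp (- t a)\<close>.

  Everything else follows from this comparison. Dominated convergence gives the convergence to zero;
  if \<open>a\<^sup>-\<^sup>\<gamma> x\<close> is square-integrable then, \<open>u\<^sup>\<gamma> exp (- u)\<close> being bounded, the same argument
  applies to \<open>t\<^sup>\<gamma> exp (- t a) x = (t a)\<^sup>\<gamma> exp (- t a) a\<^sup>-\<^sup>\<gamma> x\<close> and gives the polynomial rates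
  (theorem \<open>deviation_powr_tendsto_0\<close>). The decay is uniformly exponential precisely when \<open>a\<close> is
  bounded away from zero on \<open>I\<close>, as one sees by testing with the indicator of \<open>{0 < a < \<beta>/2}\<close>.

  It remains to identify the mild solution with the explicit one. For existence, the Bochner
  integral in the mild formulation is computed pointwise
  (theorem \<open>has_L2_bochner_integral_jointly\<close>), and the resulting one-dimensional integral of
  \<open>G' exp (- G)\<close> is evaluated for a merely measurable \<open>G'\<close> (lemma \<open>integral_exp_primitive\<close>).
  Uniqueness is Gronwall's inequality, by the norm estimate \<open>L2_dist_bochner_integral_le\<close>. Strong
  continuity of rotations and the density of simple functions both come from the induction
  principle \<open>sqint_induct\<close>. The hypotheses on the coefficient hold only almost everywhere, and \<open>a\<close> is
  an integral over a characteristic, that is, over a null set of the strip; Fubini's theorem together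
  with the rotation invariance of null sets shows that almost no characteristic is affected
  (lemma \<open>per_b_eq_q_lines\<close>).
\<close>

section \<open>Square-integrable functions\<close>

definition sqint :: "'a measure \<Rightarrow> ('a \<Rightarrow> complex) \<Rightarrow> bool" where
  "sqint M f \<longleftrightarrow> f \<in> borel_measurable M \<and> integrable M (\<lambda>x. (cmod (f x))\<^sup>2)"

definition norm2 :: "'a measure \<Rightarrow> ('a \<Rightarrow> complex) \<Rightarrow> real" where
  "norm2 M f = sqrt (LINT x|M. (cmod (f x))\<^sup>2)"

lemma sqint_measurable: "sqint M f \<Longrightarrow> f \<in> borel_measurable M"
  by (simp add: sqint_def)

lemma norm2_nonneg [simp]: "0 \<le> norm2 M f"
  by (simp add: norm2_def)

lemma norm2_power2: "(norm2 M f)\<^sup>2 = (LINT x|M. (cmod (f x))\<^sup>2)"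
  by (simp add: norm2_def)

lemma norm2_cong_AE:
  assumes "AE x in M. f x = g x" "f \<in> borel_measurable M" "g \<in> borel_measurable M"
  shows "norm2 M f = norm2 M g"
proof -
  have "(LINT x|M. (cmod (f x))\<^sup>2) = (LINT x|M. (cmod (g x))\<^sup>2)"
    using assms by (intro integral_cong_AE) auto
  then show ?thesis by (simp add: norm2_def)
qed

lemma sqint_bound_AE:
  assumes "sqint M g" "f \<in> borel_measurable M" "AE x in M. cmod (f x) \<le> K * cmod (g x)"
  shows "sqint M f"
proof -
  have int: "integrable M (\<lambda>x. K\<^sup>2 * (cmod (g x))\<^sup>2)"
    using assms(1) by (simp add: sqint_def)
  have "AE x in M. norm ((cmod (f x))\<^sup>2) \<le> norm (K\<^sup>2 * (cmod (g x))\<^sup>2)"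
    using assms(3)
  proof eventually_elim
    case (elim x)
    then have "(cmod (f x))\<^sup>2 \<le> (K * cmod (g x))\<^sup>2"
      by (intro power_mono) auto
    then show ?case by (simp add: power_mult_distrib)
  qed
  then have "integrable M (\<lambda>x. (cmod (f x))\<^sup>2)"
    by (rule Bochner_Integration.integrable_bound[OF int, rotated]) (use assms(2) in measurable)
  then show ?thesis using assms(2) by (simp add: sqint_def)
qed

lemma norm2_mono_AE:
  assumes "sqint M g" "f \<in> borel_measurable M" "AE x in M. cmod (f x) \<le> K * cmod (g x)" "0 \<le> K"
  shows "norm2 M f \<le> K * norm2 M g"
proof -
  have f: "sqint M f" using sqint_bound_AE[OF assms(1-3)] .
  have "(LINT x|M. (cmod (f x))\<^sup>2) \<le> (LINT x|M. K\<^sup>2 * (cmod (g x))\<^sup>2)"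
  proof (rule integral_mono_AE)
    show "AE x in M. (cmod (f x))\<^sup>2 \<le> K\<^sup>2 * (cmod (g x))\<^sup>2"
      using assms(3)
    proof eventually_elim
      case (elim x)
      then have "(cmod (f x))\<^sup>2 \<le> (K * cmod (g x))\<^sup>2"
        by (intro power_mono) auto
      then show ?case by (simp add: power_mult_distrib)
    qed
  qed (use f assms(1) in \<open>auto simp: sqint_def\<close>)
  then have "norm2 M f \<le> sqrt (K\<^sup>2 * (LINT x|M. (cmod (g x))\<^sup>2))"
    unfolding norm2_def by simp
  also have "\<dots> = K * norm2 M g"
    using assms(4) by (simp add: norm2_def real_sqrt_mult)
  finally show ?thesis .
qed

lemma sqint_add:
  assumes "sqint M f" "sqint M g" shows "sqint M (\<lambda>x. f x + g x)"
proof -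
  have [measurable]: "f \<in> borel_measurable M" "g \<in> borel_measurable M"
    using assms by (auto simp: sqint_def)
  have "integrable M (\<lambda>x. 2 * (cmod (f x))\<^sup>2 + 2 * (cmod (g x))\<^sup>2)"
    using assms by (auto simp: sqint_def)
  moreover have "norm ((cmod (f x + g x))\<^sup>2) \<le> norm (2 * (cmod (f x))\<^sup>2 + 2 * (cmod (g x))\<^sup>2)" for x
  proof -
    have "(cmod (f x + g x))\<^sup>2 \<le> (cmod (f x) + cmod (g x))\<^sup>2"
      by (intro power_mono norm_triangle_ineq) auto
    also have "\<dots> \<le> 2 * (cmod (f x))\<^sup>2 + 2 * (cmod (g x))\<^sup>2"
      using sum_squares_bound[of "cmod (f x)" "cmod (g x)"] by (simp add: power2_sum)
    finally show ?thesis by simp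
  qed
  ultimately have "integrable M (\<lambda>x. (cmod (f x + g x))\<^sup>2)"
    by (rule_tac Bochner_Integration.integrable_bound) auto
  then show ?thesis by (simp add: sqint_def)
qed

lemma sqint_scale: "sqint M f \<Longrightarrow> sqint M (\<lambda>x. c * f x)"
  by (auto simp: sqint_def norm_mult power_mult_distrib)

lemma sqint_diff:
  assumes "sqint M f" "sqint M g" shows "sqint M (\<lambda>x. f x - g x)"
  using sqint_add[OF assms(1) sqint_scale[OF assms(2), of "-1"]] by simp

lemma sqint_zero [simp]: "sqint M (\<lambda>x. 0)"
  by (simp add: sqint_def)

lemma norm2_scale: "norm2 M (\<lambda>x. c * f x) = cmod c * norm2 M f"
  by (simp add: norm2_def norm_mult power_mult_distrib real_sqrt_mult)

lemma norm2_minus_commute: "norm2 M (\<lambda>x. f x - g x) = norm2 M (\<lambda>x. g x - f x)"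
  by (simp add: norm2_def norm_minus_commute)

lemma sqint_mult_integrable:
  assumes "sqint M f" "sqint M g"
  shows "integrable M (\<lambda>x. cmod (f x) * cmod (g x))"
proof -
  have [measurable]: "f \<in> borel_measurable M" "g \<in> borel_measurable M"
    using assms by (auto simp: sqint_def)
  have "integrable M (\<lambda>x. (cmod (f x))\<^sup>2 + (cmod (g x))\<^sup>2)"
    using assms by (auto simp: sqint_def)
  moreover have "norm (cmod (f x) * cmod (g x)) \<le> norm ((cmod (f x))\<^sup>2 + (cmod (g x))\<^sup>2)" for x
  proof -
    have "0 \<le> cmod (f x) * cmod (g x)" by simp
    then have "cmod (f x) * cmod (g x) \<le> (cmod (f x))\<^sup>2 + (cmod (g x))\<^sup>2"
      using sum_squares_bound[of "cmod (f x)" "cmod (g x)"] by linarith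
    then show ?thesis by simp
  qed
  ultimately show ?thesis
    by (rule_tac Bochner_Integration.integrable_bound) auto
qed

lemma Cauchy_Schwarz_norm2:
  assumes "sqint M f" "sqint M g"
  shows "(LINT x|M. cmod (f x) * cmod (g x)) \<le> norm2 M f * norm2 M g"
proof -
  have [measurable]: "f \<in> borel_measurable M" "g \<in> borel_measurable M"
    using assms by (auto simp: sqint_def)
  define I where "I = (LINT x|M. cmod (f x) * cmod (g x))"
  have I0: "0 \<le> I" by (simp add: I_def)
  have "(\<integral>\<^sup>+x. ennreal (cmod (f x)) * ennreal (cmod (g x)) \<partial>M)\<^sup>2
      \<le> (\<integral>\<^sup>+x. (ennreal (cmod (f x)))\<^sup>2 \<partial>M) * (\<integral>\<^sup>+x. (ennreal (cmod (g x)))\<^sup>2 \<partial>M)"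
    by (intro Cauchy_Schwarz_nn_integral) auto
  also have "(\<integral>\<^sup>+x. (ennreal (cmod (f x)))\<^sup>2 \<partial>M) = ennreal ((norm2 M f)\<^sup>2)"
    using assms(1) by (simp add: sqint_def norm2_power2 ennreal_power nn_integral_eq_integral)
  also have "(\<integral>\<^sup>+x. (ennreal (cmod (g x)))\<^sup>2 \<partial>M) = ennreal ((norm2 M g)\<^sup>2)"
    using assms(2) by (simp add: sqint_def norm2_power2 ennreal_power nn_integral_eq_integral)
  also have "(\<integral>\<^sup>+x. ennreal (cmod (f x)) * ennreal (cmod (g x)) \<partial>M) = ennreal I"
    unfolding I_def using sqint_mult_integrable[OF assms]
    by (simp add: ennreal_mult[symmetric] nn_integral_eq_integral)
  finally have "ennreal (I\<^sup>2) \<le> ennreal ((norm2 M f * norm2 M g)\<^sup>2)"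
    by (simp add: ennreal_power I0 ennreal_mult[symmetric] power_mult_distrib)
  then have "I\<^sup>2 \<le> (norm2 M f * norm2 M g)\<^sup>2" by simp
  then show ?thesis unfolding I_def[symmetric]
    by (rule power2_le_imp_le) simp
qed

text \<open>
  Minkowski's inequality: expand the square and bound the cross term by Cauchy--Schwarz.
\<close>

lemma norm2_triangle:
  assumes "sqint M f" "sqint M g"
  shows "norm2 M (\<lambda>x. f x + g x) \<le> norm2 M f + norm2 M g"
proof (rule power2_le_imp_le)
  have "(norm2 M (\<lambda>x. f x + g x))\<^sup>2
      \<le> (LINT x|M. (cmod (f x))\<^sup>2 + 2 * (cmod (f x) * cmod (g x)) + (cmod (g x))\<^sup>2)"
    unfolding norm2_power2
  proof (rule integral_mono)
    show "integrable M (\<lambda>x. (cmod (f x + g x))\<^sup>2)"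
      using sqint_add[OF assms] by (simp add: sqint_def)
    show "integrable M (\<lambda>x. (cmod (f x))\<^sup>2 + 2 * (cmod (f x) * cmod (g x)) + (cmod (g x))\<^sup>2)"
      using assms sqint_mult_integrable[OF assms] by (auto simp: sqint_def)
    fix x
    have "(cmod (f x + g x))\<^sup>2 \<le> (cmod (f x) + cmod (g x))\<^sup>2"
      by (intro power_mono norm_triangle_ineq) auto
    then show "(cmod (f x + g x))\<^sup>2 \<le> (cmod (f x))\<^sup>2 + 2 * (cmod (f x) * cmod (g x)) + (cmod (g x))\<^sup>2"
      by (simp add: power2_sum algebra_simps)
  qed
  also have "\<dots> = (norm2 M f)\<^sup>2 + 2 * (LINT x|M. cmod (f x) * cmod (g x)) + (norm2 M g)\<^sup>2"
    using assms sqint_mult_integrable[OF assms] by (simp add: sqint_def norm2_power2)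
  also have "\<dots> \<le> (norm2 M f + norm2 M g)\<^sup>2"
    using Cauchy_Schwarz_norm2[OF assms] by (simp add: power2_sum)
  finally show "(norm2 M (\<lambda>x. f x + g x))\<^sup>2 \<le> (norm2 M f + norm2 M g)\<^sup>2" .
qed simp

lemma norm2_triangle_diff:
  assumes "sqint M f" "sqint M g" "sqint M h"
  shows "norm2 M (\<lambda>x. f x - h x) \<le> norm2 M (\<lambda>x. f x - g x) + norm2 M (\<lambda>x. g x - h x)"
  using norm2_triangle[OF sqint_diff[OF assms(1,2)] sqint_diff[OF assms(2,3)]] by simp

lemma norm2_eq_0_AE:
  assumes "sqint M f" "norm2 M f = 0" shows "AE x in M. f x = 0"
proof -
  have "(LINT x|M. (cmod (f x))\<^sup>2) = 0" using assms(2) by (simp add: norm2_def)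
  then have "AE x in M. (cmod (f x))\<^sup>2 = 0"
    using assms(1) by (subst (asm) integral_nonneg_eq_0_iff_AE) (auto simp: sqint_def)
  then show ?thesis by eventually_elim simp
qed

text \<open>
  Dominated convergence for the squares; the factor \<open>K\<close> leaves room to dominate \<open>F n - f\<close> by a
  multiple of a given function of finite norm.
\<close>

lemma tendsto_norm2_dominated:
  assumes g: "sqint M g" and F: "\<And>n. F n \<in> borel_measurable M" and f: "f \<in> borel_measurable M"
    and lim: "AE x in M. (\<lambda>n. F n x) \<longlonglongrightarrow> f x"
    and bound: "\<And>n. AE x in M. cmod (F n x - f x) \<le> K * cmod (g x)"
  shows "(\<lambda>n. norm2 M (\<lambda>x. F n x - f x)) \<longlonglongrightarrow> 0"
proof -
  note [measurable] = F f
  have "(\<lambda>n. LINT x|M. (cmod (F n x - f x))\<^sup>2) \<longlonglongrightarrow> (LINT x|M. (0::real))"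
  proof (rule integral_dominated_convergence)
    show "integrable M (\<lambda>x. K\<^sup>2 * (cmod (g x))\<^sup>2)"
      using g by (auto simp: sqint_def)
    show "AE x in M. (\<lambda>n. (cmod (F n x - f x))\<^sup>2) \<longlonglongrightarrow> 0"
      using lim
    proof eventually_elim
      case (elim x)
      have "(\<lambda>n. (cmod (F n x - f x))\<^sup>2) \<longlonglongrightarrow> (cmod (f x - f x))\<^sup>2"
        by (intro tendsto_intros elim)
      then show ?case by simp
    qed
    show "AE x in M. norm ((cmod (F n x - f x))\<^sup>2) \<le> K\<^sup>2 * (cmod (g x))\<^sup>2" for n
      using bound[of n]
    proof eventually_elim
      case (elim x)
      then have "(cmod (F n x - f x))\<^sup>2 \<le> (K * cmod (g x))\<^sup>2"
        by (intro power_mono) auto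
      then show ?case by (simp add: power_mult_distrib)
    qed
  qed auto
  then have "(\<lambda>n. sqrt (LINT x|M. (cmod (F n x - f x))\<^sup>2)) \<longlonglongrightarrow> sqrt 0"
    by (intro tendsto_real_sqrt) simp
  then show ?thesis by (simp add: norm2_def)
qed

lemma sqint_bounded:
  assumes "finite_measure M" "f \<in> borel_measurable M" "\<And>x. x \<in> space M \<Longrightarrow> cmod (f x) \<le> K"
  shows "sqint M f"
proof (rule sqint_bound_AE)
  interpret finite_measure M by fact
  show "sqint M (\<lambda>x. 1)" by (simp add: sqint_def)
  show "AE x in M. cmod (f x) \<le> K * cmod 1" using assms(3) by auto
qed fact

lemma sqint_imp_integrable:
  assumes "finite_measure M" "sqint M f" shows "integrable M f"
proof -
  interpret finite_measure M by fact
  have "sqint M (\<lambda>x. 1)" by (simp add: sqint_def)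
  from sqint_mult_integrable[OF assms(2) this] assms(2) show ?thesis
    by (auto simp: sqint_def intro: integrable_norm_cancel)
qed

text \<open>
  Any property of square-integrable functions that is linear and stable under limits in norm holds
  for all of them once it holds for the constant 1 and for the indicators of an intersection-stable
  generator: the sets whose indicators have the property form a Dynkin system, and simple functions
  are dense. The principle is used with rectangles as generator, to approximate functions of two
  variables, and with intervals, for the continuity of rotations.
\<close>

lemma sqint_induct [consumes 1, case_names measure generator_sets generator_subset Int_stable generator unit add scale lim]:
  fixes M :: "'a measure" and P :: "('a \<Rightarrow> complex) \<Rightarrow> bool"
  assumes f: "sqint M f" and fin: "finite_measure M"
    and sets: "sets M = sigma_sets (space M) G" "G \<subseteq> Pow (space M)" and int: "Int_stable G"
    and gen: "\<And>S. S \<in> G \<Longrightarrow> P (indicator S)"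
    and unit: "P (\<lambda>x. 1)"
    and add: "\<And>f g. sqint M f \<Longrightarrow> sqint M g \<Longrightarrow> P f \<Longrightarrow> P g \<Longrightarrow> P (\<lambda>x. f x + g x)"
    and scale: "\<And>f c. sqint M f \<Longrightarrow> P f \<Longrightarrow> P (\<lambda>x. c * f x)"
    and lim: "\<And>f. sqint M f \<Longrightarrow>
        (\<And>\<epsilon>::real. \<epsilon> > 0 \<Longrightarrow> \<exists>g. sqint M g \<and> P g \<and> norm2 M (\<lambda>x. f x - g x) < \<epsilon>) \<Longrightarrow> P f"
  shows "P f"
proof -
  interpret finite_measure M by fact
  have lim_seq: "P f" if f: "sqint M f" and F: "\<And>n::nat. sqint M (F n)" "\<And>n. P (F n)"
      and conv: "(\<lambda>n. norm2 M (\<lambda>x. F n x - f x)) \<longlonglongrightarrow> 0" for f F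
  proof (rule lim[OF f])
    fix \<epsilon> :: real assume "\<epsilon> > 0"
    with conv have "eventually (\<lambda>n. norm2 M (\<lambda>x. F n x - f x) < \<epsilon>) sequentially"
      by (rule order_tendstoD(2))
    then obtain n where "norm2 M (\<lambda>x. F n x - f x) < \<epsilon>"
      by (auto simp: eventually_sequentially)
    then show "\<exists>g. sqint M g \<and> P g \<and> norm2 M (\<lambda>x. f x - g x) < \<epsilon>"
      using F norm2_minus_commute[of M f "F n"] by metis
  qed
  have sqi: "sqint M (indicator S)" if "S \<in> sets M" for S
    by (rule sqint_bounded[OF fin, of _ 1]) (use that in \<open>auto split: split_indicator\<close>)
  have Psum: "sqint M (\<lambda>x. \<Sum>i\<in>J. h i x) \<and> P (\<lambda>x. \<Sum>i\<in>J. h i x)"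
    if "finite J" "\<And>i. i \<in> J \<Longrightarrow> sqint M (h i) \<and> P (h i)" for J and h :: "'b \<Rightarrow> 'a \<Rightarrow> complex"
    using that
  proof (induction J rule: finite_induct)
    case empty
    have "P (\<lambda>x. 0 * 1)" by (intro scale unit sqint_bounded[OF fin, of _ 1]) auto
    then show ?case by simp
  next
    case (insert j J)
    then show ?case using add[of "h j" "\<lambda>x. \<Sum>i\<in>J. h i x"] by (auto intro: sqint_add)
  qed
  \<comment> \<open>A limit in norm may be taken of a constant sequence, so \<open>P\<close> cannot distinguish functions that
    agree on the space of the measure.\<close>
  have null: "P f'" if "sqint M f'" "P f" "sqint M f" "\<And>x. x \<in> space M \<Longrightarrow> f x = f' x" for f f'
  proof (rule lim[OF that(1)])
    fix \<epsilon> :: real assume "\<epsilon> > 0"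
    have "norm2 M (\<lambda>x. f' x - f x) = norm2 M (\<lambda>x. 0)"
      by (rule norm2_cong_AE) (use that in \<open>auto simp: sqint_def\<close>)
    then show "\<exists>g. sqint M g \<and> P g \<and> norm2 M (\<lambda>x. f' x - g x) < \<epsilon>"
      using that \<open>\<epsilon> > 0\<close> by (intro exI[of _ f]) (simp add: norm2_def)
  qed
  have ind: "P (indicator S)" if "S \<in> sets M" for S
  proof -
    from that have "S \<in> sigma_sets (space M) G" by (simp add: sets)
    with int sets(2) show ?thesis
    proof (induction rule: sigma_sets_induct_disjoint)
      case (basic A)
      then show ?case by (rule gen)
    next
      case empty
      have "P (\<lambda>x. 0 * 1)" by (intro scale unit sqint_bounded[OF fin, of _ 1]) auto
      then show ?case by (simp add: indicator_def[abs_def])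
    next
      case (compl A)
      then have A: "A \<in> sets M" by (simp add: sets)
      \<comment> \<open>On the space this is the indicator of the complement.\<close>
      have "P (\<lambda>x. 1 + (-1) * indicator A x)"
        by (intro add unit scale sqint_scale sqi A compl sqint_bounded[OF fin, of _ 1]) auto
      then show ?case
        by (rule null[rotated]) (use A in \<open>auto intro!: sqi sqint_bounded[OF fin, of _ 1] split: split_indicator\<close>)
    next
      case (union A)
      then have A: "A i \<in> sets M" for i by (auto simp: sets)
      have U: "(\<Union>i. A i) \<in> sets M" using A by auto
      show ?case
      proof (rule lim_seq[OF sqi[OF U], where F = "\<lambda>n x. \<Sum>i<n. indicator (A i) x"])
        have S: "sqint M (\<lambda>x. \<Sum>i<n. indicator (A i) x) \<and> P (\<lambda>x. \<Sum>i<n. indicator (A i) x)" for n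
          by (rule Psum) (use sqi[OF A] union in auto)
        show "sqint M (\<lambda>x. \<Sum>i<n. indicator (A i) x)" for n using S by auto
        show "P (\<lambda>x. \<Sum>i<n. indicator (A i) x)" for n using S by auto
        have eq: "(\<Sum>i<n. indicator (A i) x :: complex) = indicator (\<Union>i<n. A i) x" for n x
          using disjoint_family_on_mono[OF _ union(1)] by (intro indicator_UN_disjoint[symmetric]) auto
        show "(\<lambda>n. norm2 M (\<lambda>x. (\<Sum>i<n. indicator (A i) x) - indicator (\<Union>i. A i) x)) \<longlonglongrightarrow> 0"
          unfolding eq
        proof (rule tendsto_norm2_dominated[where g="\<lambda>x. 1" and K=1])
          show "AE x in M. (\<lambda>n. indicator (\<Union>i<n. A i) x) \<longlonglongrightarrow> (indicator (\<Union>i. A i) x :: complex)"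
          proof (rule AE_I2)
            fix x
            show "(\<lambda>n. indicator (\<Union>i<n. A i) x) \<longlonglongrightarrow> (indicator (\<Union>i. A i) x :: complex)"
              by (rule LIMSEQ_indicator_UN)
          qed
          show "sqint M (\<lambda>x. 1)" by (intro sqint_bounded[OF fin, of _ 1]) auto
        qed (use A in \<open>auto split: split_indicator\<close>)
      qed
    qed
  qed
  have fm: "f \<in> borel_measurable M" using f by (simp add: sqint_def)
  from borel_measurable_implies_sequence_metric[OF this, of 0]
  obtain F where F: "\<And>i. simple_function M (F i)" "\<And>x. x \<in> space M \<Longrightarrow> (\<lambda>i. F i x) \<longlonglongrightarrow> f x"
    "\<And>i x. x \<in> space M \<Longrightarrow> dist (F i x) 0 \<le> 2 * dist (f x) 0"
    by blast
  have Fm: "F i \<in> borel_measurable M" for i using F(1) by (rule borel_measurable_simple_function)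
  have Fsq: "sqint M (F i)" for i
    by (rule sqint_bound_AE[OF f Fm, of _ 2]) (use F(3) in auto)
  show ?thesis
  proof (rule lim_seq[OF f Fsq])
    show "(\<lambda>n. norm2 M (\<lambda>x. F n x - f x)) \<longlonglongrightarrow> 0"
    proof (rule tendsto_norm2_dominated[OF f, where K=3])
      show "AE x in M. cmod (F n x - f x) \<le> 3 * cmod (f x)" for n
      proof (rule AE_I2)
        fix x assume "x \<in> space M"
        then show "cmod (F n x - f x) \<le> 3 * cmod (f x)"
          using F(3)[of x n] norm_triangle_ineq4[of "F n x" "f x"] by simp
      qed
    qed (use F(2) Fm fm in auto)
    fix n
    have finF: "finite (F n ` space M)" using F(1) by (rule simple_functionD)
    have lev: "F n -` {c} \<inter> space M \<in> sets M" for c using F(1) by (rule simple_functionD)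
    have "sqint M (\<lambda>x. \<Sum>c\<in>F n ` space M. c * indicator (F n -` {c} \<inter> space M) x) \<and>
        P (\<lambda>x. \<Sum>c\<in>F n ` space M. c * indicator (F n -` {c} \<inter> space M) x)"
      by (rule Psum[OF finF]) (intro conjI sqint_scale scale ind sqi lev)
    moreover have "(\<Sum>c\<in>F n ` space M. c * indicator (F n -` {c} \<inter> space M) x) = F n x"
      if "x \<in> space M" for x
    proof -
      have "(\<Sum>c\<in>F n ` space M. c * indicator (F n -` {c} \<inter> space M) x)
          = (\<Sum>c\<in>F n ` space M. if c = F n x then c else 0)"
        using that by (intro sum.cong) (auto split: split_indicator)
      then show ?thesis using finF that by simp
    qed
    ultimately show "P (F n)"
      using null[OF Fsq] by blast
  qed
qed

section \<open>Minkowski's integral inequality\<close>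

lemma sqint_snd:
  assumes "finite_measure N" "finite_measure U" "sqint U v"
  shows "sqint (N \<Otimes>\<^sub>M U) (\<lambda>p. v (snd p))"
proof -
  interpret N: finite_measure N by fact
  interpret U: finite_measure U by fact
  interpret NU: pair_sigma_finite N U ..
  have [measurable]: "v \<in> borel_measurable U" using assms by (simp add: sqint_def)
  have "integrable (N \<Otimes>\<^sub>M U) (\<lambda>p. (cmod (v (snd p)))\<^sup>2)"
    by (rule NU.Fubini_integrable) (use assms in \<open>auto simp: sqint_def\<close>)
  then show ?thesis by (simp add: sqint_def)
qed

text \<open>
  A square-integrable function of two variables is regarded as a function of \<open>r\<close> whose values
  \<open>k r\<close> lie in \<open>L\<^sup>2\<close>. Fubini's theorem for \<open>\<bar>k\<bar>\<^sup>2\<close> controls almost all sections in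
  either variable; on a finite measure, Cauchy--Schwarz against the constant 1 then bounds the
  integral of the norms of the sections by the norm on the product.
\<close>

lemma product_sections:
  assumes N: "finite_measure N" and U: "finite_measure U" and k: "sqint (N \<Otimes>\<^sub>M U) (\<lambda>(r, s). k r s)"
  shows norm2_section_measurable: "(\<lambda>r. norm2 U (k r)) \<in> borel_measurable N"
    and AE_sqint_section: "AE r in N. sqint U (k r)"
    and AE_sqint_cosection: "AE s in U. sqint N (\<lambda>r. k r s)"
    and integrable_norm2_section: "integrable N (\<lambda>r. norm2 U (k r))"
    and integral_norm2_section_le:
      "(LINT r|N. norm2 U (k r)) \<le> sqrt (measure N (space N)) * norm2 (N \<Otimes>\<^sub>M U) (\<lambda>(r, s). k r s)"
proof -
  interpret N: finite_measure N by fact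
  interpret U: finite_measure U by fact
  interpret NU: pair_sigma_finite N U ..
  have km [measurable]: "(\<lambda>(r, s). k r s) \<in> borel_measurable (N \<Otimes>\<^sub>M U)"
    and ki: "integrable (N \<Otimes>\<^sub>M U) (\<lambda>(r, s). (cmod (k r s))\<^sup>2)"
    using k by (auto simp: sqint_def case_prod_beta')
  show m: "(\<lambda>r. norm2 U (k r)) \<in> borel_measurable N"
    unfolding norm2_def by measurable
  have sec: "k r \<in> borel_measurable U" if "r \<in> space N" for r
    using measurable_Pair2[OF km that] by simp
  have cosec: "(\<lambda>r. k r s) \<in> borel_measurable N" if "s \<in> space U" for s
    using measurable_Pair1[OF km that] by simp
  show "AE r in N. sqint U (k r)"
    using NU.AE_integrable_fst[OF ki] sec AE_space[of N] by (auto simp: sqint_def elim: eventually_elim2)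
  show "AE s in U. sqint N (\<lambda>r. k r s)"
    using NU.AE_integrable_snd[OF ki] AE_space[of U] 
    by eventually_elim (auto simp: sqint_def cosec)
  let ?n = "\<lambda>r. complex_of_real (norm2 U (k r))"
  have sq: "sqint N ?n"
    using NU.integrable_fst[OF ki] m by (auto simp: sqint_def norm2_power2)
  have one: "sqint N (\<lambda>r. 1)" by (intro sqint_bounded[OF N, of _ 1]) auto
  show "integrable N (\<lambda>r. norm2 U (k r))"
    using sqint_mult_integrable[OF one sq] by simp
  have "norm2 N ?n = norm2 (N \<Otimes>\<^sub>M U) (\<lambda>(r, s). k r s)"
    using NU.integral_fst[OF ki] by (simp add: norm2_def[of N] norm2_power2) (simp add: norm2_def case_prod_beta')
  moreover have "norm2 N (\<lambda>r. 1) = sqrt (measure N (space N))"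
    by (simp add: norm2_def)
  ultimately show "(LINT r|N. norm2 U (k r)) \<le> sqrt (measure N (space N)) * norm2 (N \<Otimes>\<^sub>M U) (\<lambda>(r, s). k r s)"
    using Cauchy_Schwarz_norm2[OF one sq] by simp
qed

text \<open>
  The norm of an integral is at most the integral of the norms. With \<open>Y\<close> for the integral,
  \<open>\<parallel>Y\<parallel>\<^sup>2 \<le> \<integral>\<integral> \<bar>Y s\<bar> \<bar>k r s\<bar> ds dr \<le> \<parallel>Y\<parallel> \<integral> \<parallel>k r\<parallel> dr\<close> by Fubini and Cauchy--Schwarz, and one
  factor \<open>\<parallel>Y\<parallel>\<close> cancels.
\<close>

lemma Minkowski_integral:
  assumes N: "finite_measure N" and U: "finite_measure U" and k: "sqint (N \<Otimes>\<^sub>M U) (\<lambda>(r, s). k r s)"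
  shows sqint_integral: "sqint U (\<lambda>s. LINT r|N. k r s)"
    and norm2_integral_le: "norm2 U (\<lambda>s. LINT r|N. k r s) \<le> (LINT r|N. norm2 U (k r))"
proof -
  interpret N: finite_measure N by fact
  interpret U: finite_measure U by fact
  interpret NU: pair_sigma_finite N U ..
  have km [measurable]: "(\<lambda>(r, s). k r s) \<in> borel_measurable (N \<Otimes>\<^sub>M U)"
    and ki: "integrable (N \<Otimes>\<^sub>M U) (\<lambda>(r, s). (cmod (k r s))\<^sup>2)"
    using k by (auto simp: sqint_def case_prod_beta')
  have [measurable]: "(\<lambda>(s, r). k r s) \<in> borel_measurable (U \<Otimes>\<^sub>M N)"
    using measurable_compose[OF measurable_pair_swap' km] by (simp add: case_prod_beta')
  define Y where "Y = (\<lambda>s. LINT r|N. k r s)"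
  have Ym [measurable]: "Y \<in> borel_measurable U"
    unfolding Y_def by measurable
  have one: "sqint N (\<lambda>r. 1)" by (intro sqint_bounded[OF N, of _ 1]) auto
  have abs: "cmod (Y s) \<le> (LINT r|N. cmod (k r s))" for s
    unfolding Y_def by (rule integral_norm_bound)
  have "integrable U (\<lambda>s. (cmod (Y s))\<^sup>2)"
  proof (rule Bochner_Integration.integrable_bound)
    show "integrable U (\<lambda>s. measure N (space N) * (LINT r|N. (cmod (k r s))\<^sup>2))"
      using NU.integrable_snd[OF ki] by simp
    show "AE s in U. norm ((cmod (Y s))\<^sup>2) \<le> norm (measure N (space N) * (LINT r|N. (cmod (k r s))\<^sup>2))"
      using AE_sqint_cosection[OF N U k]
    proof eventually_elim
      case (elim s)
      have "cmod (Y s) \<le> (LINT r|N. cmod (k r s) * cmod 1)" using abs by simp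
      also have "\<dots> \<le> norm2 N (\<lambda>r. k r s) * norm2 N (\<lambda>r. 1)"
        by (rule Cauchy_Schwarz_norm2[OF elim one])
      finally have "(cmod (Y s))\<^sup>2 \<le> (norm2 N (\<lambda>r. k r s) * norm2 N (\<lambda>r. 1))\<^sup>2"
        by (intro power_mono) auto
      then show ?case by (simp add: power_mult_distrib norm2_power2 mult.commute)
    qed
  qed measurable
  then have Y: "sqint U Y" by (simp add: sqint_def)
  then show "sqint U (\<lambda>s. LINT r|N. k r s)" by (simp add: Y_def)
  have int: "integrable (N \<Otimes>\<^sub>M U) (\<lambda>(r, s). cmod (Y s) * cmod (k r s))"
    using sqint_mult_integrable[OF sqint_snd[OF N U Y] k] by (simp add: case_prod_beta')
  have "(norm2 U Y)\<^sup>2 \<le> (LINT s|U. LINT r|N. cmod (Y s) * cmod (k r s))"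
    unfolding norm2_power2
  proof (rule integral_mono)
    show "integrable U (\<lambda>s. (cmod (Y s))\<^sup>2)" using Y by (simp add: sqint_def)
    show "integrable U (\<lambda>s. LINT r|N. cmod (Y s) * cmod (k r s))" by (rule NU.integrable_snd[OF int])
    show "(cmod (Y s))\<^sup>2 \<le> (LINT r|N. cmod (Y s) * cmod (k r s))" for s
      using mult_left_mono[OF abs[of s], of "cmod (Y s)"] by (simp add: power2_eq_square)
  qed
  also have "\<dots> = (LINT r|N. LINT s|U. cmod (Y s) * cmod (k r s))"
    by (rule NU.Fubini_integral[OF int])
  also have "\<dots> \<le> (LINT r|N. norm2 U Y * norm2 U (k r))"
  proof (rule integral_mono_AE)
    show "integrable N (\<lambda>r. LINT s|U. cmod (Y s) * cmod (k r s))" by (rule NU.integrable_fst[OF int])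
    show "integrable N (\<lambda>r. norm2 U Y * norm2 U (k r))"
      using integrable_norm2_section[OF N U k] by simp
    show "AE r in N. (LINT s|U. cmod (Y s) * cmod (k r s)) \<le> norm2 U Y * norm2 U (k r)"
      using AE_sqint_section[OF N U k] by eventually_elim (rule Cauchy_Schwarz_norm2[OF Y])
  qed
  finally have *: "norm2 U Y * norm2 U Y \<le> norm2 U Y * (LINT r|N. norm2 U (k r))"
    by (simp add: power2_eq_square)
  have "0 \<le> (LINT r|N. norm2 U (k r))" by simp
  then show "norm2 U (\<lambda>s. LINT r|N. k r s) \<le> (LINT r|N. norm2 U (k r))"
    using * norm2_nonneg[of U Y] unfolding Y_def[symmetric]
    by (cases "norm2 U Y = 0") (auto simp: mult_le_cancel_left)
qed

section \<open>Bochner integrals in the space of square-integrable functions\<close>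

lemma finite_measure_unit: "finite_measure unit_measure"
  by (rule finite_measureI) (simp add: space_restrict_space emeasure_restrict_space)

lemma L2_space_sqint: "x \<in> L2_space \<longleftrightarrow> sqint unit_measure x"
  by (simp add: L2_space_def sqint_def)

lemma L2_norm_norm2: "L2_norm x = norm2 unit_measure x"
  by (simp add: L2_norm_def norm2_def)

lemma L2_dist_norm2: "L2_dist x y = norm2 unit_measure (\<lambda>s. x s - y s)"
  by (simp add: L2_dist_def L2_norm_norm2)

context
  fixes A :: "real set"
  assumes A [measurable]: "A \<in> sets borel" and finA: "emeasure lborel A < \<infinity>"
begin

lemma finite_measure_restrict: "finite_measure (restrict_space lborel A)"
  using A finA by (intro finite_measureI) (simp add: space_restrict_space emeasure_restrict_space less_top)

lemma set_integrable_iff_restrict: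
  "set_integrable lborel A f \<longleftrightarrow> integrable (restrict_space lborel A) f"
  for f :: "real \<Rightarrow> 'b::{banach, second_countable_topology}"
  unfolding set_integrable_def using A by (simp add: integrable_restrict_space)

lemma set_integral_eq_restrict:
  "(LINT r:A|lborel. f r) = (LINT r|restrict_space lborel A. f r)"
  for f :: "real \<Rightarrow> 'b::{banach, second_countable_topology}"
  unfolding set_lebesgue_integral_def using A by (simp add: integral_restrict_space)

lemma AE_restrict_iff: "(AE r in restrict_space lborel A. P r) \<longleftrightarrow> (AE r in lborel. r \<in> A \<longrightarrow> P r)"
  using A by (simp add: AE_restrict_space_iff)

lemma sqint_simple_val:
  assumes "is_simple L"
  shows "sqint (restrict_space lborel A \<Otimes>\<^sub>M unit_measure) (\<lambda>(r, s). simple_val L r s)"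
  using assms
proof (induction L)
  case Nil
  then show ?case by (simp add: simple_val_def case_prod_beta')
next
  case (Cons Ev L)
  obtain E v where Ev: "Ev = (E, v)" by force
  from Cons.prems Ev have [measurable]: "E \<in> sets borel" and v: "sqint unit_measure v" and L: "is_simple L"
    by (auto simp: is_simple_def L2_space_sqint)
  from v have [measurable]: "v \<in> borel_measurable unit_measure" by (simp add: sqint_def)
  have "(\<lambda>p. indicator E (fst p)) \<in> borel_measurable (restrict_space lborel A \<Otimes>\<^sub>M unit_measure)"
    by (rule measurable_compose[OF measurable_fst measurable_restrict_space1]) auto
  then have "(\<lambda>(r, s). indicator E r * v s) \<in> borel_measurable (restrict_space lborel A \<Otimes>\<^sub>M unit_measure)"
    unfolding case_prod_beta' by (intro borel_measurable_times) auto
  then have "sqint (restrict_space lborel A \<Otimes>\<^sub>M unit_measure) (\<lambda>(r, s). indicator E r * v s)"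
    by (rule_tac sqint_bound_AE[OF sqint_snd[OF finite_measure_restrict finite_measure_unit v], of _ 1])
       (auto simp: norm_mult split: split_indicator)
  from sqint_add[OF this Cons.IH[OF L]] show ?case
    by (simp add: simple_val_def Ev case_prod_beta')
qed

lemma integral_simple_val:
  assumes "is_simple L"
  shows "integrable (restrict_space lborel A) (\<lambda>r. simple_val L r s) \<and>
    (LINT r|restrict_space lborel A. simple_val L r s) = simple_int A L s"
  using assms
proof (induction L)
  case Nil
  then show ?case by (simp add: simple_val_def simple_int_def)
next
  case (Cons Ev L)
  interpret finite_measure "restrict_space lborel A" by (rule finite_measure_restrict)
  obtain E v where Ev: "Ev = (E, v)" by force
  from Cons.prems Ev have [measurable]: "E \<in> sets borel" and L: "is_simple L"
    by (auto simp: is_simple_def)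
  have int: "integrable (restrict_space lborel A) (\<lambda>r. indicator E r :: complex)"
    by (rule integrable_const_bound[of _ 1])
       (auto split: split_indicator intro!: measurable_restrict_space1)
  have "(LINT r|restrict_space lborel A. indicator E r :: complex) = complex_of_real (measure lborel (E \<inter> A))"
  proof -
    have "(indicator E r :: complex) = complex_of_real (indicator E r)" for r
      by (simp split: split_indicator)
    moreover have "(LINT r|restrict_space lborel A. indicator E r) = measure (restrict_space lborel A) (E \<inter> A)"
      by (subst Bochner_Integration.integral_indicator) (simp_all add: space_restrict_space)
    ultimately show ?thesis
      using A by (simp add: measure_restrict_space)
  qed
  then show ?case
    using Cons.IH[OF L] int by (simp add: simple_val_def simple_int_def Ev)
qed

text \<open>
  The integral of a simple function is the pointwise integral of its values, so Minkowski's
  inequality compares it with the pointwise integral of any \<open>f\<close>.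
\<close>

lemma L2_dist_simple_int_le:
  assumes f: "sqint (restrict_space lborel A \<Otimes>\<^sub>M unit_measure) (\<lambda>(r, s). f r s)" and L: "is_simple L"
  shows "L2_dist (simple_int A L) (\<lambda>s. LINT r|restrict_space lborel A. f r s)
    \<le> (LINT r|restrict_space lborel A. L2_dist (f r) (simple_val L r))"
proof -
  let ?N = "restrict_space lborel A"
  note fin = finite_measure_restrict finite_measure_unit
  have fL: "sqint (?N \<Otimes>\<^sub>M unit_measure) (\<lambda>(r, s). f r s - simple_val L r s)"
    using sqint_diff[OF f sqint_simple_val[OF L]] by (simp add: case_prod_beta')
  have "L2_dist (simple_int A L) (\<lambda>s. LINT r|?N. f r s) = norm2 unit_measure (\<lambda>s. (LINT r|?N. f r s) - simple_int A L s)"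
    by (simp add: L2_dist_norm2 norm2_minus_commute)
  also have "\<dots> = norm2 unit_measure (\<lambda>s. LINT r|?N. f r s - simple_val L r s)"
  proof (rule norm2_cong_AE)
    show "AE s in unit_measure. (LINT r|?N. f r s) - simple_int A L s = (LINT r|?N. f r s - simple_val L r s)"
      using AE_sqint_cosection[OF fin f]
    proof eventually_elim
      case (elim s)
      then have "integrable ?N (\<lambda>r. f r s)" by (rule sqint_imp_integrable[OF fin(1)])
      then show ?case using integral_simple_val[OF L, of s] by simp
    qed
    have "sqint unit_measure (\<lambda>s. (LINT r|?N. f r s) - (LINT r|?N. simple_val L r s))"
      by (intro sqint_diff sqint_integral fin f sqint_simple_val L)
    then show "(\<lambda>s. (LINT r|?N. f r s) - simple_int A L s) \<in> borel_measurable unit_measure"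
      using integral_simple_val[OF L] by (simp add: sqint_def)
    show "(\<lambda>s. LINT r|?N. f r s - simple_val L r s) \<in> borel_measurable unit_measure"
      using sqint_integral[OF fin fL] by (simp add: sqint_def)
  qed
  also have "\<dots> \<le> (LINT r|?N. norm2 unit_measure (\<lambda>s. f r s - simple_val L r s))"
    by (rule norm2_integral_le[OF fin fL])
  finally show ?thesis by (simp add: L2_dist_norm2)
qed

text \<open>
  Rectangles generate the product \<open>\<sigma>\<close>-algebra, and the indicator of a rectangle \<open>E \<times> F\<close> is
  the simple function with the single value \<open>1\<^sub>F\<close> on \<open>E\<close>.
\<close>

lemma simple_dense:
  assumes h: "sqint (restrict_space lborel A \<Otimes>\<^sub>M unit_measure) h" and "\<epsilon> > 0"
  shows "\<exists>L. is_simple L \<and>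
    norm2 (restrict_space lborel A \<Otimes>\<^sub>M unit_measure) (\<lambda>(r, s). h (r, s) - simple_val L r s) < \<epsilon>"
proof -
  let ?N = "restrict_space lborel A"
  let ?M = "?N \<Otimes>\<^sub>M unit_measure"
  interpret N: finite_measure ?N by (rule finite_measure_restrict)
  interpret U: finite_measure unit_measure by (rule finite_measure_unit)
  interpret NU: pair_sigma_finite ?N unit_measure ..
  have finM: "finite_measure ?M"
    using U.emeasure_pair_measure_Times[OF sets.top sets.top, of ?N] N.emeasure_finite U.emeasure_finite
    by (intro finite_measureI) (simp add: space_pair_measure ennreal_mult_eq_top_iff)
  have val: "sqint ?M (\<lambda>p. simple_val L (fst p) (snd p))" if "is_simple L" for L
    using sqint_simple_val[OF that] by (simp add: case_prod_beta')
  have rect: "\<forall>\<epsilon>>0. \<exists>L. is_simple L \<and> norm2 ?M (\<lambda>p. indicator (E \<times> F) p - simple_val L (fst p) (snd p)) < \<epsilon>"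
    if "E \<in> sets ?N" "F \<in> sets unit_measure" for E F
  proof (intro allI impI)
    fix \<epsilon> :: real assume "\<epsilon> > 0"
    let ?L = "[(E, indicator F)] :: L2_simple"
    have E: "E \<in> sets lborel" "E \<subseteq> A"
      using that(1) by (auto simp: sets_restrict_space_iff)
    then have "emeasure lborel E < \<infinity>"
      using emeasure_mono[OF E(2), of lborel] finA by (auto simp: less_top[symmetric] top_unique)
    moreover have "sqint unit_measure (indicator F)"
      by (rule sqint_bounded[OF finite_measure_unit, of _ 1]) (use that in \<open>auto split: split_indicator\<close>)
    ultimately have "is_simple ?L" using E by (simp add: is_simple_def L2_space_sqint)
    moreover have "indicator (E \<times> F) p - simple_val ?L (fst p) (snd p) = 0" for p
      by (cases p) (simp add: simple_val_def indicator_times)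
    ultimately show "\<exists>L. is_simple L \<and> norm2 ?M (\<lambda>p. indicator (E \<times> F) p - simple_val L (fst p) (snd p)) < \<epsilon>"
      using \<open>\<epsilon> > 0\<close> by (intro exI[of _ ?L]) (simp add: norm2_def)
  qed
  have "\<forall>\<epsilon>>0. \<exists>L. is_simple L \<and> norm2 ?M (\<lambda>p. h p - simple_val L (fst p) (snd p)) < \<epsilon>"
    using h
  proof (induction h rule: sqint_induct[where G = "{E \<times> F | E F. E \<in> sets ?N \<and> F \<in> sets unit_measure}"])
    case measure
    then show ?case by (rule finM)
  next
    case generator_sets
    then show ?case by (simp add: sets_pair_measure space_pair_measure)
  next
    case generator_subset
    then show ?case using sets.space_closed[of ?N] sets.space_closed[of unit_measure] by (auto simp: space_pair_measure)
  next
    case Int_stable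
    then show ?case by (rule Int_stable_pair_measure_generator)
  next
    case (generator S)
    then show ?case using rect by blast
  next
    case unit
    have m: "(\<lambda>p. indicator (space ?N \<times> space unit_measure) p :: complex) \<in> borel_measurable ?M"
      by (intro borel_measurable_indicator pair_measureI sets.top)
    have eq: "norm2 ?M (\<lambda>p. 1 - simple_val L (fst p) (snd p))
        = norm2 ?M (\<lambda>p. indicator (space ?N \<times> space unit_measure) p - simple_val L (fst p) (snd p))"
      if "is_simple L" for L
      by (rule norm2_cong_AE[OF AE_I2
            borel_measurable_diff[OF borel_measurable_const sqint_measurable[OF val[OF that]]]
            borel_measurable_diff[OF m sqint_measurable[OF val[OF that]]]])
         (auto simp: space_pair_measure)
    show ?case
    proof (intro allI impI)
      fix \<epsilon> :: real assume "\<epsilon> > 0"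
      then obtain L where "is_simple L"
        "norm2 ?M (\<lambda>p. indicator (space ?N \<times> space unit_measure) p - simple_val L (fst p) (snd p)) < \<epsilon>"
        using rect[OF sets.top sets.top] by blast
      then show "\<exists>L. is_simple L \<and> norm2 ?M (\<lambda>p. 1 - simple_val L (fst p) (snd p)) < \<epsilon>"
        using eq[of L] by (intro exI[of _ L]) (simp only: simp_thms)
    qed
  next
    case (add f g)
    show ?case
    proof (intro allI impI)
      fix \<epsilon> :: real assume "\<epsilon> > 0"
      with add(3,4) obtain L L' where L: "is_simple L" "norm2 ?M (\<lambda>p. f p - simple_val L (fst p) (snd p)) < \<epsilon> / 2"
        and L': "is_simple L'" "norm2 ?M (\<lambda>p. g p - simple_val L' (fst p) (snd p)) < \<epsilon> / 2"
        by (meson half_gt_zero)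
      have "norm2 ?M (\<lambda>p. (f p + g p) - simple_val (L @ L') (fst p) (snd p))
          = norm2 ?M (\<lambda>p. (f p - simple_val L (fst p) (snd p)) + (g p - simple_val L' (fst p) (snd p)))"
        by (simp add: simple_val_def algebra_simps)
      also have "\<dots> < \<epsilon>"
        using norm2_triangle[OF sqint_diff[OF add(1) val[OF L(1)]] sqint_diff[OF add(2) val[OF L'(1)]]] L(2) L'(2)
        by simp
      finally show "\<exists>L. is_simple L \<and> norm2 ?M (\<lambda>p. (f p + g p) - simple_val L (fst p) (snd p)) < \<epsilon>"
        using L(1) L'(1) by (intro exI[of _ "L @ L'"]) (auto simp: is_simple_def)
    qed
  next
    case (scale f c)
    show ?case
    proof (intro allI impI)
      fix \<epsilon> :: real assume "\<epsilon> > 0"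
      have pos: "cmod c + 1 > 0" by (simp add: add_nonneg_pos)
      with \<open>\<epsilon> > 0\<close> have "\<epsilon> / (cmod c + 1) > 0" by simp
      with scale obtain L where L: "is_simple L"
        and d: "norm2 ?M (\<lambda>p. f p - simple_val L (fst p) (snd p)) < \<epsilon> / (cmod c + 1)"
        by meson
      let ?L = "map (\<lambda>(E, v). (E, \<lambda>s. c * v s)) L"
      have "simple_val ?L r s = c * simple_val L r s" for r s
        by (induction L) (auto simp: simple_val_def algebra_simps)
      then have "norm2 ?M (\<lambda>p. c * f p - simple_val ?L (fst p) (snd p))
          = cmod c * norm2 ?M (\<lambda>p. f p - simple_val L (fst p) (snd p))"
        by (simp add: norm2_scale[symmetric] right_diff_distrib)
      also have "\<dots> \<le> (cmod c + 1) * norm2 ?M (\<lambda>p. f p - simple_val L (fst p) (snd p))"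
        by (simp add: mult_right_mono)
      also have "\<dots> < \<epsilon>" using d pos by (simp add: pos_less_divide_eq mult.commute)
      finally show "\<exists>L. is_simple L \<and> norm2 ?M (\<lambda>p. c * f p - simple_val L (fst p) (snd p)) < \<epsilon>"
        using L by (intro exI[of _ ?L]) (auto simp: is_simple_def L2_space_sqint sqint_scale)
    qed
  next
    case (lim f)
    show ?case
    proof (intro allI impI)
      fix \<epsilon> :: real assume "\<epsilon> > 0"
      then obtain g where g: "sqint ?M g" "norm2 ?M (\<lambda>p. f p - g p) < \<epsilon> / 2"
        and "\<forall>\<epsilon>>0. \<exists>L. is_simple L \<and> norm2 ?M (\<lambda>p. g p - simple_val L (fst p) (snd p)) < \<epsilon>"
        using lim(2)[of "\<epsilon> / 2"] by auto
      then obtain L where L: "is_simple L" "norm2 ?M (\<lambda>p. g p - simple_val L (fst p) (snd p)) < \<epsilon> / 2"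
        using \<open>\<epsilon> > 0\<close> by (meson half_gt_zero)
      then show "\<exists>L. is_simple L \<and> norm2 ?M (\<lambda>p. f p - simple_val L (fst p) (snd p)) < \<epsilon>"
        using norm2_triangle_diff[OF lim(1) g(1) val[OF L(1)]] g(2) by (intro exI[of _ L]) auto
    qed
  qed
  then show ?thesis using assms(2) by (simp add: case_prod_beta')
qed

text \<open>
  For jointly square-integrable \<open>f\<close> the Bochner integral exists and is computed pointwise in \<open>s\<close>:
  simple functions that approximate \<open>f\<close> in the norm of the product approximate \<open>r \<mapsto> f r\<close> in
  \<open>L\<^sup>1(A; X)\<close>, and Minkowski's inequality carries this over to the integrals. This is how the
  explicit solution is recognised as a mild one.
\<close>

theorem has_L2_bochner_integral_jointly:
  assumes f: "sqint (restrict_space lborel A \<Otimes>\<^sub>M unit_measure) (\<lambda>(r, s). f r s)"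
  shows "has_L2_bochner_integral A f (\<lambda>s. LINT r:A|lborel. f r s)"
proof -
  let ?N = "restrict_space lborel A"
  let ?M = "?N \<Otimes>\<^sub>M unit_measure"
  let ?y = "\<lambda>s. LINT r|?N. f r s"
  note fin = finite_measure_restrict finite_measure_unit
  have "\<exists>L. is_simple L \<and> norm2 ?M (\<lambda>(r, s). f r s - simple_val L r s) < inverse (real (Suc n))" for n
    using simple_dense[OF f, of "inverse (real (Suc n))"] by simp
  then obtain L where L: "\<And>n. is_simple (L n)"
    and d: "\<And>n. norm2 ?M (\<lambda>(r, s). f r s - simple_val (L n) r s) < inverse (real (Suc n))"
    by metis
  have fL: "sqint ?M (\<lambda>(r, s). f r s - simple_val (L n) r s)" for n
    using sqint_diff[OF f sqint_simple_val[OF L]] by (simp add: case_prod_beta')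
  have lim: "(\<lambda>n. LINT r|?N. L2_dist (f r) (simple_val (L n) r)) \<longlonglongrightarrow> 0"
  proof (rule tendsto_sandwich[OF always_eventually always_eventually tendsto_const])
    show "\<forall>n. 0 \<le> (LINT r|?N. L2_dist (f r) (simple_val (L n) r))"
      by (simp add: L2_dist_norm2)
    show "\<forall>n. (LINT r|?N. L2_dist (f r) (simple_val (L n) r)) \<le> sqrt (measure ?N (space ?N)) * inverse (real (Suc n))"
      unfolding L2_dist_norm2
      by (intro allI order_trans[OF integral_norm2_section_le[OF fin fL] mult_left_mono[OF less_imp_le[OF d]]]) simp
    have "(\<lambda>n. sqrt (measure ?N (space ?N)) * inverse (real (Suc n))) \<longlonglongrightarrow> sqrt (measure ?N (space ?N)) * 0"
      by (intro tendsto_mult tendsto_const LIMSEQ_inverse_real_of_nat)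
    then show "(\<lambda>n. sqrt (measure ?N (space ?N)) * inverse (real (Suc n))) \<longlonglongrightarrow> 0" by simp
  qed
  have "(\<lambda>n. L2_dist (simple_int A (L n)) ?y) \<longlonglongrightarrow> 0"
    by (rule tendsto_sandwich[OF always_eventually always_eventually tendsto_const lim])
       (auto simp: L2_dist_simple_int_le[OF f L], simp add: L2_dist_norm2)
  then show ?thesis
    unfolding has_L2_bochner_integral_def set_integral_eq_restrict set_integrable_iff_restrict
    using lim L integrable_norm2_section[OF fin fL] sqint_integral[OF fin f]
      AE_sqint_section[OF fin f] by (auto simp: AE_restrict_iff L2_space_sqint L2_dist_norm2)
qed

text \<open>
  The norm estimate that Gronwall's inequality needs. It compares two integrals directly, because a
  Bochner integral of the difference would require \<open>r \<mapsto> L2_dist (f r - g r) (h r)\<close> to be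
  measurable for simple \<open>h\<close>, whereas the definition provides this only for \<open>f\<close> and \<open>g\<close> separately and
  for their own approximating functions. Instead \<open>\<phi>\<close> is an integrable majorant of the
  distance of the integrands, and the triangle inequality is applied to approximating simple
  functions.
\<close>

lemma L2_dist_bochner_integral_le:
  assumes f: "has_L2_bochner_integral A f y" and g: "has_L2_bochner_integral A g w"
    and \<phi>: "set_integrable lborel A \<phi>" and le: "AE r in lborel. r \<in> A \<longrightarrow> L2_dist (f r) (g r) \<le> \<phi> r"
  shows "L2_dist y w \<le> (LINT r:A|lborel. \<phi> r)"
proof -
  let ?N = "restrict_space lborel A"
  let ?M = "?N \<Otimes>\<^sub>M unit_measure"
  note fin = finite_measure_restrict finite_measure_unit
  from f obtain K where y: "sqint unit_measure y" and fK: "AE r in ?N. sqint unit_measure (f r)"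
    and K: "\<And>n. is_simple (K n)" "\<And>n. integrable ?N (\<lambda>r. L2_dist (f r) (simple_val (K n) r))"
      "(\<lambda>n. LINT r|?N. L2_dist (f r) (simple_val (K n) r)) \<longlonglongrightarrow> 0"
      "(\<lambda>n. L2_dist (simple_int A (K n)) y) \<longlonglongrightarrow> 0"
    unfolding has_L2_bochner_integral_def set_integral_eq_restrict set_integrable_iff_restrict
    by (auto simp: L2_space_sqint AE_restrict_iff)
  from g obtain L where w: "sqint unit_measure w" and gL: "AE r in ?N. sqint unit_measure (g r)"
    and L: "\<And>n. is_simple (L n)" "\<And>n. integrable ?N (\<lambda>r. L2_dist (g r) (simple_val (L n) r))"
      "(\<lambda>n. LINT r|?N. L2_dist (g r) (simple_val (L n) r)) \<longlonglongrightarrow> 0"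
      "(\<lambda>n. L2_dist (simple_int A (L n)) w) \<longlonglongrightarrow> 0"
    unfolding has_L2_bochner_integral_def set_integral_eq_restrict set_integrable_iff_restrict
    by (auto simp: L2_space_sqint AE_restrict_iff)
  have \<phi>i: "integrable ?N \<phi>" using \<phi> by (simp add: set_integrable_iff_restrict)
  have int: "sqint unit_measure (simple_int A J)" if "is_simple J" for J
    using sqint_integral[OF fin sqint_simple_val[OF that]] integral_simple_val[OF that] by simp
  have leN: "AE r in ?N. L2_dist (f r) (g r) \<le> \<phi> r" using le by (simp add: AE_restrict_iff)
  have sec: "AE r in ?N. sqint unit_measure (simple_val J r)" if "is_simple J" for J
    by (rule AE_sqint_section[OF fin sqint_simple_val[OF that]])
  have bound: "L2_dist y w \<le> L2_dist (simple_int A (K n)) y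
      + ((LINT r|?N. L2_dist (f r) (simple_val (K n) r)) + (LINT r|?N. \<phi> r)
         + (LINT r|?N. L2_dist (g r) (simple_val (L n) r)))
      + L2_dist (simple_int A (L n)) w" for n
  proof -
    have "L2_dist y w \<le> L2_dist y (simple_int A (K n)) + L2_dist (simple_int A (K n)) w"
      unfolding L2_dist_norm2 by (rule norm2_triangle_diff[OF y int[OF K(1)] w])
    also have "L2_dist (simple_int A (K n)) w \<le> L2_dist (simple_int A (K n)) (simple_int A (L n)) + L2_dist (simple_int A (L n)) w"
      unfolding L2_dist_norm2 by (rule norm2_triangle_diff[OF int[OF K(1)] int[OF L(1)] w])
    also have "L2_dist (simple_int A (K n)) (simple_int A (L n))
        \<le> (LINT r|?N. L2_dist (simple_val (L n) r) (simple_val (K n) r))"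
      using L2_dist_simple_int_le[OF sqint_simple_val[OF L(1)] K(1)] integral_simple_val[OF L(1)] by simp
    also have "\<dots> \<le> (LINT r|?N. L2_dist (f r) (simple_val (K n) r) + \<phi> r + L2_dist (g r) (simple_val (L n) r))"
    proof (rule integral_mono_AE)
      have "sqint ?M (\<lambda>(r, s). simple_val (L n) r s - simple_val (K n) r s)"
        using sqint_diff[OF sqint_simple_val[OF L(1)] sqint_simple_val[OF K(1)]] by (simp add: case_prod_beta')
      from integrable_norm2_section[OF fin this]
      show "integrable ?N (\<lambda>r. L2_dist (simple_val (L n) r) (simple_val (K n) r))"
        by (simp add: L2_dist_norm2)
      show "AE r in ?N. L2_dist (simple_val (L n) r) (simple_val (K n) r)
          \<le> L2_dist (f r) (simple_val (K n) r) + \<phi> r + L2_dist (g r) (simple_val (L n) r)"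
        using fK gL leN sec[OF K(1)[of n]] sec[OF L(1)[of n]]
      proof eventually_elim
        case (elim r)
        have "L2_dist (simple_val (L n) r) (simple_val (K n) r)
            \<le> L2_dist (simple_val (L n) r) (g r) + L2_dist (g r) (simple_val (K n) r)"
          unfolding L2_dist_norm2 using elim by (intro norm2_triangle_diff)
        moreover have "L2_dist (g r) (simple_val (K n) r) \<le> L2_dist (g r) (f r) + L2_dist (f r) (simple_val (K n) r)"
          unfolding L2_dist_norm2 using elim by (intro norm2_triangle_diff)
        moreover have "L2_dist (g r) (f r) = L2_dist (f r) (g r)"
          "L2_dist (simple_val (L n) r) (g r) = L2_dist (g r) (simple_val (L n) r)"
          unfolding L2_dist_norm2 by (rule norm2_minus_commute)+
        ultimately show ?case using elim(3) by simp
      qed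
    qed (use K L \<phi>i in auto)
    also have "\<dots> = (LINT r|?N. L2_dist (f r) (simple_val (K n) r)) + (LINT r|?N. \<phi> r)
         + (LINT r|?N. L2_dist (g r) (simple_val (L n) r))"
      using K L \<phi>i by simp
    finally show ?thesis by (simp add: L2_dist_norm2 norm2_minus_commute)
  qed
  have "(\<lambda>n. L2_dist (simple_int A (K n)) y
      + ((LINT r|?N. L2_dist (f r) (simple_val (K n) r)) + (LINT r|?N. \<phi> r)
         + (LINT r|?N. L2_dist (g r) (simple_val (L n) r)))
      + L2_dist (simple_int A (L n)) w) \<longlonglongrightarrow> 0 + (0 + (LINT r|?N. \<phi> r) + 0) + 0"
    by (intro tendsto_add tendsto_const K L)
  from LIMSEQ_le_const[OF this] bound show ?thesis by (auto simp: set_integral_eq_restrict)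
qed

end

section \<open>The rotation group on the unit interval\<close>

lemma frac_frac_add: "frac (frac a + b) = frac (a + b)" for a b :: real
proof -
  have "a + b = (frac a + b) + of_int \<lfloor>a\<rfloor>" by (simp add: frac_def)
  then show ?thesis by (metis frac_add_of_int_right)
qed

lemma borel_measurable_frac [measurable]: "(frac :: real \<Rightarrow> real) \<in> borel_measurable borel"
  unfolding frac_def by measurable

lemma per_ext_cut: "per_ext f s = (if frac s \<in> {0<..<1} then f (frac s) else 0)" for s :: real
  using frac_ge_0[of s] frac_lt_1[of s] by (auto simp: per_ext_def)

lemma per_ext_unit:
  assumes "s \<in> {0<..<1}" shows "per_ext f s = f s"
proof -
  have "frac s = s" using assms by (simp add: frac_eq)
  then show ?thesis using assms by (simp add: per_ext_cut)
qed

lemma borel_measurable_cut: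
  fixes x :: "real \<Rightarrow> 'b::real_normed_vector"
  assumes "x \<in> borel_measurable unit_measure"
  shows "(\<lambda>s. if s \<in> {0<..<1} then x s else 0) \<in> borel_measurable borel"
proof -
  have "(\<lambda>s. indicator {0<..<1} s *\<^sub>R x s) \<in> borel_measurable lborel"
    using assms by (subst (asm) borel_measurable_restrict_space_iff) auto
  moreover have "(\<lambda>s. indicator {0<..<1} s *\<^sub>R x s) = (\<lambda>s. if s \<in> {0<..<1} then x s else 0)"
    by (auto simp: fun_eq_iff)
  ultimately show ?thesis by (simp only: measurable_lborel2)
qed

lemma borel_measurable_per_ext:
  fixes x :: "real \<Rightarrow> 'b::real_normed_vector"
  assumes "x \<in> borel_measurable unit_measure"
  shows "per_ext x \<in> borel_measurable borel"
  using measurable_compose[OF borel_measurable_frac borel_measurable_cut[OF assms]]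
  by (simp add: per_ext_cut[abs_def])

lemma borel_measurable_T0:
  assumes "x \<in> borel_measurable unit_measure" shows "T0 t x \<in> borel_measurable borel"
  unfolding T0_def by (rule measurable_compose[OF _ borel_measurable_per_ext[OF assms]]) simp

lemma T0_measurable_unit:
  assumes "x \<in> borel_measurable unit_measure" shows "T0 t x \<in> borel_measurable unit_measure"
  using borel_measurable_T0[OF assms] by (intro measurable_restrict_space1) simp

text \<open>
  Rotation of the circle preserves Lebesgue measure. With \<open>c = frac t\<close>, the points of \<open>(0,1)\<close> that
  rotate into \<open>S\<close> are a translate of \<open>S \<inter> (c,1)\<close> together with a translate of \<open>S \<inter> [0,c)\<close>;
  these two pieces make up \<open>S \<inter> (0,1)\<close> apart from at most the two points \<open>0\<close> and \<open>c\<close>.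
\<close>

lemma distr_unit_shift: "distr unit_measure borel (\<lambda>s. frac (s + t)) = distr unit_measure borel (\<lambda>s. s)"
proof (rule measure_eqI)
  fix S assume "S \<in> sets (distr unit_measure borel (\<lambda>s. frac (s + t)))"
  then have S [measurable]: "S \<in> sets borel" by simp
  define c where "c = frac t"
  have c: "0 \<le> c" "c < 1" by (auto simp: c_def frac_lt_1)
  have fr: "frac (s + t) = (if s + c < 1 then s + c else s + c - 1)" if "0 < s" "s < 1" for s
  proof -
    have "frac (s + t) = frac (s + c)" using frac_frac_add[of t s] by (simp add: c_def add.commute)
    also have "\<dots> = (if s + c < 1 then s + c else s + c - 1)"
      using that c by (auto simp: frac_unique_iff)
    finally show ?thesis .
  qed
  have shift: "emeasure lborel ((+) d -` T) = emeasure lborel T" if [measurable]: "T \<in> sets borel" for d :: real and T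
    using arg_cong[OF lborel_distr_plus[of d], of "\<lambda>M. emeasure M T"]
    by (subst (asm) emeasure_distr) auto
  have eq: "(\<lambda>s. frac (s + t)) -` S \<inter> {0<..<1} = (+) c -` (S \<inter> {c<..<1}) \<union> (+) (c - 1) -` (S \<inter> {0..<c})"
    using c by (auto simp: fr add.commute algebra_simps split: if_splits)
  have "emeasure (distr unit_measure borel (\<lambda>s. frac (s + t))) S
      = emeasure unit_measure ((\<lambda>s. frac (s + t)) -` S \<inter> {0<..<1})"
    by (subst emeasure_distr) (auto simp: space_restrict_space intro!: measurable_restrict_space1)
  also have "\<dots> = emeasure lborel ((\<lambda>s. frac (s + t)) -` S \<inter> {0<..<1})"
    by (rule emeasure_restrict_space) auto
  also have "\<dots> = emeasure lborel ((+) c -` (S \<inter> {c<..<1})) + emeasure lborel ((+) (c - 1) -` (S \<inter> {0..<c}))"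
    unfolding eq by (rule plus_emeasure[symmetric]) (use c in \<open>auto intro!: measurable_sets_borel\<close>)
  also have "\<dots> = emeasure lborel (S \<inter> {c<..<1}) + emeasure lborel (S \<inter> {0..<c})"
    using shift[of "S \<inter> {c<..<1}" c] shift[of "S \<inter> {0..<c}" "c - 1"] by (simp del: vimage_Int)
  also have "\<dots> = emeasure lborel (S \<inter> {c<..<1} \<union> S \<inter> {0..<c})"
    by (rule plus_emeasure) auto
  also have "\<dots> = emeasure lborel (S \<inter> {0<..<1})"
  proof (rule emeasure_eq_AE)
    show "AE x in lborel. (x \<in> S \<inter> {c<..<1} \<union> S \<inter> {0..<c}) = (x \<in> S \<inter> {0<..<1})"
      using AE_lborel_singleton[of 0] AE_lborel_singleton[of c]
      by eventually_elim (use c in auto)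
  qed auto
  also have "\<dots> = emeasure unit_measure (S \<inter> {0<..<1})"
    by (rule emeasure_restrict_space[symmetric]) auto
  also have "\<dots> = emeasure (distr unit_measure borel (\<lambda>s. s)) S"
    by (subst emeasure_distr) (auto simp: space_restrict_space intro!: measurable_restrict_space1)
  finally show "emeasure (distr unit_measure borel (\<lambda>s. frac (s + t))) S
      = emeasure (distr unit_measure borel (\<lambda>s. s)) S" .
qed simp

text \<open>
  The form in which invariance is used for almost-everywhere statements. The part \<open>frac (s + t) \<noteq> 0\<close>
  excludes the single point where the periodic extension takes its default value.
\<close>

lemma AE_unit_shift:
  assumes "AE s in unit_measure. P s"
  shows "AE s in unit_measure. frac (s + t) \<noteq> 0 \<and> P (frac (s + t))"
proof -
  obtain N where N: "{s \<in> space unit_measure. \<not> P s} \<subseteq> N" "emeasure unit_measure N = 0" "N \<in> sets unit_measure"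
    using assms by (rule AE_E)
  have Nb [measurable]: "N \<in> sets borel" and N01: "N \<subseteq> {0<..<1}"
    using N(3) by (auto simp: sets_restrict_space_iff)
  \<comment> \<open>Adding the point 0 to the exceptional set accounts for \<open>frac (s + t) = 0\<close>.\<close>
  let ?N = "(\<lambda>s. frac (s + t)) -` (insert 0 N) \<inter> {0<..<1}"
  have "emeasure unit_measure ?N = emeasure (distr unit_measure borel (\<lambda>s. frac (s + t))) (insert 0 N)"
    by (subst emeasure_distr) (auto simp: space_restrict_space intro!: measurable_restrict_space1)
  also have "\<dots> = emeasure unit_measure (insert 0 N \<inter> {0<..<1})"
    unfolding distr_unit_shift
    by (subst emeasure_distr) (auto simp: space_restrict_space intro!: measurable_restrict_space1)
  also have "insert 0 N \<inter> {0<..<1} = N" using N01 by auto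
  finally have "emeasure unit_measure ?N = 0" using N(2) by simp
  moreover have "?N \<in> sets unit_measure"
    by (auto simp: sets_restrict_space_iff)
  ultimately show ?thesis
  proof (intro AE_I[of _ _ ?N] subsetI)
    fix s assume "s \<in> {s \<in> space unit_measure. \<not> (frac (s + t) \<noteq> 0 \<and> P (frac (s + t)))}"
    then have s: "s \<in> {0<..<1}" "frac (s + t) = 0 \<or> \<not> P (frac (s + t))"
      by (auto simp: space_restrict_space)
    show "s \<in> ?N"
    proof (cases "frac (s + t) = 0")
      case False
      then have "frac (s + t) \<in> {s \<in> space unit_measure. \<not> P s}"
        using s frac_ge_0[of "s + t"] frac_lt_1[of "s + t"] by (simp add: space_restrict_space)
      with N(1) s(1) show ?thesis by blast
    qed (use s in simp)
  qed auto
qed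

lemma
  assumes x: "x \<in> borel_measurable unit_measure"
  shows sqint_T0_iff: "sqint unit_measure (T0 t x) \<longleftrightarrow> sqint unit_measure x"
    and norm2_T0: "norm2 unit_measure (T0 t x) = norm2 unit_measure x"
proof -
  define w where "w = (\<lambda>s. if s \<in> {0<..<1} then x s else 0)"
  have w [measurable]: "w \<in> borel_measurable borel"
    unfolding w_def by (rule borel_measurable_cut[OF x])
  have T: "T0 t x s = w (frac (s + t))" for s by (simp add: T0_def per_ext_cut w_def)
  have m: "(\<lambda>s. frac (s + t)) \<in> measurable unit_measure borel" "(\<lambda>s. s) \<in> measurable unit_measure borel"
    by (auto intro!: measurable_restrict_space1)
  have "integrable unit_measure (\<lambda>s. (cmod (T0 t x s))\<^sup>2)
      \<longleftrightarrow> integrable (distr unit_measure borel (\<lambda>s. frac (s + t))) (\<lambda>s. (cmod (w s))\<^sup>2)"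
    unfolding T by (subst integrable_distr_eq[OF m(1)]) auto
  also have "\<dots> \<longleftrightarrow> integrable unit_measure (\<lambda>s. (cmod (w s))\<^sup>2)"
    unfolding distr_unit_shift by (subst integrable_distr_eq[OF m(2)]) auto
  also have "\<dots> \<longleftrightarrow> integrable unit_measure (\<lambda>s. (cmod (x s))\<^sup>2)"
    by (rule Bochner_Integration.integrable_cong) (auto simp: w_def space_restrict_space)
  finally show "sqint unit_measure (T0 t x) \<longleftrightarrow> sqint unit_measure x"
    using x T0_measurable_unit[OF x] by (simp add: sqint_def)
  have "(LINT s|unit_measure. (cmod (T0 t x s))\<^sup>2)
      = (LINT s|distr unit_measure borel (\<lambda>s. frac (s + t)). (cmod (w s))\<^sup>2)"
    unfolding T by (subst integral_distr[OF m(1)]) auto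
  also have "\<dots> = (LINT s|unit_measure. (cmod (w s))\<^sup>2)"
    unfolding distr_unit_shift by (subst integral_distr[OF m(2)]) auto
  also have "\<dots> = (LINT s|unit_measure. (cmod (x s))\<^sup>2)"
    by (rule Bochner_Integration.integral_cong) (auto simp: w_def space_restrict_space)
  finally show "norm2 unit_measure (T0 t x) = norm2 unit_measure x"
    by (simp add: norm2_def)
qed

lemma T0_add: "T0 t (\<lambda>s. x s + y s) s = T0 t x s + T0 t y s"
  and T0_diff: "T0 t (\<lambda>s. x s - y s) s = T0 t x s - T0 t y s"
  and T0_scale: "T0 t (\<lambda>s. c * x s) s = c * T0 t x s"
  by (auto simp: T0_def per_ext_def)

lemma per_ext_T0: "per_ext (T0 t x) s = (if frac s = 0 then 0 else per_ext x (s + t))"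
  by (simp add: per_ext_def T0_def frac_frac_add del: frac_eq_0_iff)

text \<open>
  The group law holds only almost everywhere: a periodic extension of a periodic extension vanishes
  at one additional point per period.
\<close>

lemma T0_T0_AE: "AE s in unit_measure. T0 t (T0 r x) s = T0 (t + r) x s"
proof -
  have "AE s in unit_measure. True" by simp
  from AE_unit_shift[OF this, of t] show ?thesis
  proof eventually_elim
    case (elim s)
    have "T0 t (T0 r x) s = per_ext (T0 r x) (s + t)" by (simp add: T0_def[of t])
    also have "\<dots> = per_ext x (s + t + r)" using elim by (simp add: per_ext_T0)
    finally show ?case by (simp add: T0_def add.assoc)
  qed
qed

lemma T0_isometric:
  assumes "x \<in> borel_measurable unit_measure" "y \<in> borel_measurable unit_measure"
  shows "L2_dist (T0 t x) (T0 t y) = L2_dist x y"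
proof -
  have "L2_dist (T0 t x) (T0 t y) = norm2 unit_measure (T0 t (\<lambda>s. x s - y s))"
    by (simp add: L2_dist_norm2 T0_diff[abs_def])
  then show ?thesis using assms by (simp add: norm2_T0 L2_dist_norm2)
qed

text \<open>
  Strong continuity of the rotation group. The functions for which it holds form a closed subspace,
  because all \<open>T0 h\<close> are isometries, and for the indicator of an interval \<open>(0,c)\<close> the translates
  converge at every point other than \<open>c\<close>.
\<close>

lemma T0_continuous_at_0:
  assumes "sqint unit_measure x"
  shows "((\<lambda>h. norm2 unit_measure (\<lambda>s. T0 h x s - x s)) \<longlongrightarrow> 0) (at 0)"
  using assms
proof (induction x rule: sqint_induct[where G = "(\<inter>) {0<..<1} ` range lessThan"])
  case measure
  then show ?case by (rule finite_measure_unit)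
next
  case generator_sets
  have "sets unit_measure = (\<inter>) {0<..<1} ` sigma_sets UNIV (range lessThan)"
    by (simp add: sets_restrict_space borel_Iio)
  also have "\<dots> = sigma_sets {0<..<1} ((\<inter>) {0<..<1} ` range lessThan)"
  proof (rule sigma_sets_Int)
    have "{0<..<1::real} \<in> sets borel" by simp
    then show "{0<..<1::real} \<in> sigma_sets UNIV (range lessThan)" by (simp add: borel_Iio)
  qed simp
  finally show ?case by (simp add: space_restrict_space)
next
  case generator_subset
  then show ?case by (auto simp: space_restrict_space)
next
  case Int_stable
  have "{0<..<1} \<inter> {..<a} \<inter> ({0<..<1} \<inter> {..<b}) = {0<..<1::real} \<inter> {..<min a b}" for a b :: real
    by auto
  then show ?case unfolding Int_stable_def by auto
next
  case (generator S)
  then obtain c :: real where S: "S = {0<..<1} \<inter> {..<c}" by auto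
  show ?case
    unfolding tendsto_at_iff_sequentially comp_def
  proof (intro allI impI)
    fix X :: "nat \<Rightarrow> real" assume X: "X \<longlonglongrightarrow> 0"
    have Sm [measurable]: "(indicator S :: real \<Rightarrow> complex) \<in> borel_measurable unit_measure"
      unfolding S by (intro measurable_restrict_space1) auto
    show "(\<lambda>n. norm2 unit_measure (\<lambda>s. T0 (X n) (indicator S) s - indicator S s)) \<longlonglongrightarrow> 0"
    proof (rule tendsto_norm2_dominated[where g = "\<lambda>s. 1" and K = 2])
      show "sqint unit_measure (\<lambda>s. 1)"
        by (rule sqint_bounded[OF finite_measure_unit, of _ 1]) auto
      show "T0 (X n) (indicator S) \<in> borel_measurable unit_measure" for n
        by (rule T0_measurable_unit[OF Sm])
      show "AE s in unit_measure. cmod (T0 (X n) (indicator S) s - indicator S s) \<le> 2 * cmod 1" for n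
        by (auto simp: T0_def per_ext_def split: split_indicator)
      have "AE s in lborel. s \<noteq> c" by (rule AE_lborel_singleton)
      then have "AE s in unit_measure. s \<noteq> c \<and> s \<in> {0<..<1}"
        by (auto simp: AE_restrict_space_iff)
      then show "AE s in unit_measure. (\<lambda>n. T0 (X n) (indicator S) s) \<longlonglongrightarrow> indicator S s"
      proof eventually_elim
        case (elim s)
        have lim: "(\<lambda>n. s + X n) \<longlonglongrightarrow> s" using tendsto_add[OF tendsto_const X, of s] by simp
        have "eventually (\<lambda>n. s + X n > 0 \<and> s + X n < 1 \<and> (s + X n < c \<longleftrightarrow> s < c)) sequentially"
          using order_tendstoD(1)[OF lim, of 0] order_tendstoD(2)[OF lim, of 1]
            order_tendstoD(1)[OF lim, of c] order_tendstoD(2)[OF lim, of c] elim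
          by (cases "s < c") (auto elim: eventually_elim2 intro: eventually_conj)
        then have "eventually (\<lambda>n. T0 (X n) (indicator S) s = (indicator S s :: complex)) sequentially"
        proof eventually_elim
          case (elim n)
          then have "frac (s + X n) = s + X n" by (simp add: frac_eq)
          with elim \<open>s \<noteq> c \<and> s \<in> {0<..<1}\<close> show ?case
            by (auto simp: T0_def per_ext_def S split: split_indicator simp del: frac_eq_0_iff)
        qed
        then show ?case by (rule tendsto_eventually)
      qed
    qed (rule Sm)
  qed
next
  case unit
  have "norm2 unit_measure (\<lambda>s. T0 h (\<lambda>s. 1) s - 1) = norm2 unit_measure (\<lambda>s. 0)" for h
  proof (rule norm2_cong_AE)
    have "AE s in unit_measure. True" by simp
    from AE_unit_shift[OF this, of h] show "AE s in unit_measure. T0 h (\<lambda>s. 1) s - 1 = 0"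
      by eventually_elim (simp add: T0_def per_ext_def)
  qed (auto intro!: borel_measurable_diff T0_measurable_unit)
  then show ?case by (simp add: norm2_def)
next
  case (add f g)
  have le: "norm2 unit_measure (\<lambda>s. T0 h (\<lambda>s. f s + g s) s - (f s + g s))
      \<le> norm2 unit_measure (\<lambda>s. T0 h f s - f s) + norm2 unit_measure (\<lambda>s. T0 h g s - g s)" for h
    using norm2_triangle[of unit_measure "\<lambda>s. T0 h f s - f s" "\<lambda>s. T0 h g s - g s"] add(1,2)
    by (simp add: T0_add sqint_diff sqint_T0_iff sqint_measurable algebra_simps)
  show ?case
    by (rule tendsto_sandwich[OF always_eventually always_eventually tendsto_const
          tendsto_add[OF add(3,4), simplified]]) (use le in auto)
next
  case (scale f c)
  have "norm2 unit_measure (\<lambda>s. T0 h (\<lambda>s. c * f s) s - c * f s) = cmod c * norm2 unit_measure (\<lambda>s. T0 h f s - f s)" for h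
    by (simp add: T0_scale norm2_scale[symmetric] right_diff_distrib)
  then show ?case using tendsto_mult_right_zero[OF scale(2)] by simp
next
  case (lim f)
  show ?case
  proof (rule tendstoI)
    fix \<epsilon> :: real assume "\<epsilon> > 0"
    then obtain g where g: "sqint unit_measure g" and conv: "((\<lambda>h. norm2 unit_measure (\<lambda>s. T0 h g s - g s)) \<longlongrightarrow> 0) (at 0)"
      and d: "norm2 unit_measure (\<lambda>s. f s - g s) < \<epsilon> / 3"
      using lim(2)[of "\<epsilon> / 3"] by auto
    have "eventually (\<lambda>h. norm2 unit_measure (\<lambda>s. T0 h g s - g s) < \<epsilon> / 3) (at 0)"
      using order_tendstoD(2)[OF conv, of "\<epsilon> / 3"] \<open>\<epsilon> > 0\<close> by simp
    then show "eventually (\<lambda>h. dist (norm2 unit_measure (\<lambda>s. T0 h f s - f s)) 0 < \<epsilon>) (at 0)"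
    proof eventually_elim
      case (elim h)
      have T: "sqint unit_measure (T0 h f)" "sqint unit_measure (T0 h g)"
        using lim(1) g by (auto simp: sqint_T0_iff sqint_measurable)
      have "norm2 unit_measure (\<lambda>s. T0 h f s - f s)
          \<le> norm2 unit_measure (\<lambda>s. T0 h f s - T0 h g s) + norm2 unit_measure (\<lambda>s. T0 h g s - f s)"
        by (rule norm2_triangle_diff[OF T lim(1)])
      also have "norm2 unit_measure (\<lambda>s. T0 h g s - f s)
          \<le> norm2 unit_measure (\<lambda>s. T0 h g s - g s) + norm2 unit_measure (\<lambda>s. g s - f s)"
        by (rule norm2_triangle_diff[OF T(2) g lim(1)])
      also have "norm2 unit_measure (\<lambda>s. g s - f s) = norm2 unit_measure (\<lambda>s. f s - g s)"
        by (rule norm2_minus_commute)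
      also have "norm2 unit_measure (\<lambda>s. T0 h f s - T0 h g s) = norm2 unit_measure (\<lambda>s. f s - g s)"
        using T0_isometric[of f g h] lim(1) g by (simp add: L2_dist_norm2 sqint_measurable)
      finally show ?case using elim d by simp
    qed
  qed
qed

lemma T0_strongly_continuous:
  assumes x: "sqint unit_measure x"
  shows "((\<lambda>r. L2_dist (T0 r x) (T0 t x)) \<longlongrightarrow> 0) (at t)"
proof -
  have m: "x \<in> borel_measurable unit_measure" using x by (rule sqint_measurable)
  note mT = T0_measurable_unit[OF m] T0_measurable_unit[OF T0_measurable_unit[OF m]]
  have eq: "L2_dist (T0 r x) (T0 t x) = norm2 unit_measure (\<lambda>s. T0 (r - t) (T0 t x) s - T0 t x s)" for r
    unfolding L2_dist_norm2
  proof (rule norm2_cong_AE)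
    show "AE s in unit_measure. T0 r x s - T0 t x s = T0 (r - t) (T0 t x) s - T0 t x s"
      using T0_T0_AE[of "r - t" t x] by eventually_elim simp
  qed (intro borel_measurable_diff mT)+
  have "sqint unit_measure (T0 t x)" using x m by (simp add: sqint_T0_iff)
  from T0_continuous_at_0[OF this] show ?thesis
    unfolding eq by (subst LIM_offset_zero_iff[of t]) auto
qed

section \<open>Primitives of bounded functions and Gronwall's inequality\<close>

text \<open>
  Summing over \<open>n + 1\<close> equal pieces of \<open>[0,t]\<close> bounds the total increment by
  \<open>K t\<^sup>2 / (n + 1)\<close>.
\<close>

lemma constant_if_quadratic_increments:
  fixes f :: "real \<Rightarrow> real"
  assumes inc: "\<And>u v. 0 \<le> u \<Longrightarrow> u \<le> v \<Longrightarrow> \<bar>f v - f u\<bar> \<le> K * (v - u)\<^sup>2" and t: "0 \<le> t"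
  shows "f t = f 0"
proof -
  have "\<bar>f t - f 0\<bar> \<le> K * t\<^sup>2 * inverse (real (Suc n))" for n
  proof -
    let ?p = "\<lambda>i. real i * (t / real (Suc n))"
    have "\<bar>f t - f 0\<bar> = \<bar>\<Sum>i<Suc n. f (?p (Suc i)) - f (?p i)\<bar>"
      by (subst sum_lessThan_telescope) simp
    also have "\<dots> \<le> (\<Sum>i<Suc n. \<bar>f (?p (Suc i)) - f (?p i)\<bar>)" by (rule sum_abs)
    also have "\<dots> \<le> (\<Sum>i<Suc n. K * (t / real (Suc n))\<^sup>2)"
    proof (rule sum_mono)
      fix i
      have "?p (Suc i) - ?p i = t / real (Suc n)" by (simp only: left_diff_distrib[symmetric]) simp
      moreover have "?p i \<le> ?p (Suc i)" by (intro mult_right_mono) (use t in auto)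
      ultimately show "\<bar>f (?p (Suc i)) - f (?p i)\<bar> \<le> K * (t / real (Suc n))\<^sup>2"
        using inc[of "?p i" "?p (Suc i)"] t by simp
    qed
    also have "\<dots> = K * t\<^sup>2 * inverse (real (Suc n))"
    proof -
      have "N * (K * (t / N)\<^sup>2) = K * t\<^sup>2 * inverse N" if "N \<noteq> 0" for N :: real
        using that by (simp add: power2_eq_square field_simps)
      from this[of "real (Suc n)"] show ?thesis by simp
    qed
    finally show ?thesis .
  qed
  moreover have "(\<lambda>n. K * t\<^sup>2 * inverse (real (Suc n))) \<longlonglongrightarrow> K * t\<^sup>2 * 0"
    by (intro tendsto_mult tendsto_const LIMSEQ_inverse_real_of_nat)
  ultimately have "\<bar>f t - f 0\<bar> \<le> K * t\<^sup>2 * 0"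
    by (intro LIMSEQ_le_const) auto
  then show ?thesis by simp
qed

lemma set_integral_Icc_same: "(LINT r:{a..a}|lborel. h r) = 0" for a :: real and h :: "real \<Rightarrow> real"
  unfolding set_lebesgue_integral_def
  by (rule integral_eq_zero_AE, rule AE_mp[OF AE_lborel_singleton[of a]]) (auto split: split_indicator)

lemma bounded_set_integrable:
  assumes [measurable]: "h \<in> borel_measurable borel" and h: "\<And>r. \<bar>h r\<bar> \<le> K"
    and [measurable]: "S \<in> sets borel" and S: "S \<subseteq> {u..v}"
  shows "set_integrable lborel S (h :: real \<Rightarrow> real)"
  unfolding set_integrable_def
proof (rule integrableI_bounded_set[where A = "{u..v}" and B = K])
  show "AE x in lborel. x \<in> {u..v} \<longrightarrow> norm (indicat_real S x *\<^sub>R h x) \<le> K"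
    using h order_trans[OF abs_ge_zero h] by (auto split: split_indicator)
  show "AE x in lborel. x \<notin> {u..v} \<longrightarrow> indicat_real S x *\<^sub>R h x = 0"
    by (intro AE_I2) (use S in \<open>auto split: split_indicator\<close>)
qed (auto simp: emeasure_lborel_Icc_eq)

lemma integral_Icc_split:
  assumes h: "(h :: real \<Rightarrow> real) \<in> borel_measurable borel" "\<And>r. \<bar>h r\<bar> \<le> K" and uv: "0 \<le> u" "u \<le> v"
  shows "(LINT r:{0..v}|lborel. h r) = (LINT r:{0..u}|lborel. h r) + (LINT r:{u<..v}|lborel. h r)"
proof -
  have eq: "{0..v} = {0..u} \<union> {u<..v}" using uv by auto
  show ?thesis unfolding eq
    by (rule set_integral_Un; (intro bounded_set_integrable[OF h, of _ 0 v])?) (use uv in auto)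
qed

context
  fixes g :: "real \<Rightarrow> real" and C :: real
  assumes gm [measurable]: "g \<in> borel_measurable borel" and g0: "\<And>r. 0 \<le> g r" and gC: "\<And>r. g r \<le> C"
begin

lemma increment_bounds:
  assumes uv: "0 \<le> u" "u \<le> v"
  shows "0 \<le> (LINT r:{u<..v}|lborel. g r)" "(LINT r:{u<..v}|lborel. g r) \<le> C * (v - u)"
proof -
  have "0 \<le> C" using g0[of 0] gC[of 0] by simp
  show "0 \<le> (LINT r:{u<..v}|lborel. g r)"
    unfolding set_lebesgue_integral_def by (rule integral_nonneg_AE) (auto simp: g0)
  have "(LINT r:{u<..v}|lborel. g r) \<le> (LINT r:{u<..v}|lborel. C)"
    by (rule set_integral_mono; (rule bounded_set_integrable[of _ C _ u v])?)
       (use g0 gC \<open>0 \<le> C\<close> in auto)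
  also have "\<dots> = C * (v - u)" using uv by (simp add: set_integral_const)
  finally show "(LINT r:{u<..v}|lborel. g r) \<le> C * (v - u)" .
qed

lemma integral_increment:
  assumes "0 \<le> u" "u \<le> v"
  shows "(LINT r:{0..v}|lborel. g r) = (LINT r:{0..u}|lborel. g r) + (LINT r:{u<..v}|lborel. g r)"
  by (rule integral_Icc_split[OF gm _ assms, of C]) (use g0 gC in auto)

text \<open>
  The fundamental theorem of calculus for \<open>t \<mapsto> - exp (- D t)\<close>, where \<open>D\<close> is the indefinite
  integral of \<open>g\<close>. As \<open>g\<close> is only bounded and measurable, \<open>D\<close> need not be differentiable at every
  point. But \<open>F = exp (- D) + \<integral> g exp (- D)\<close> has quadratic increments: over \<open>(u,v]\<close> the exponent
  grows by some \<open>d \<le> C (v - u)\<close>, and both \<open>exp (- D v) - exp (- D u)\<close> and minus the integral equal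
  \<open>- d exp (- D u)\<close> up to an error of at most \<open>d\<^sup>2\<close>.
\<close>

lemma integral_exp_primitive:
  assumes m [measurable]: "(\<lambda>t. LINT r:{0..t}|lborel. g r) \<in> borel_measurable borel" and t: "0 \<le> t"
  shows "(LINT r:{0..t}|lborel. g r * exp (- (LINT \<rho>:{0..r}|lborel. g \<rho>))) = 1 - exp (- (LINT r:{0..t}|lborel. g r))"
proof -
  define D where "D = (\<lambda>t. LINT r:{0..t}|lborel. g r)"
  have [measurable]: "D \<in> borel_measurable borel" unfolding D_def by (rule m)
  have C0: "0 \<le> C" using g0[of 0] gC[of 0] by simp
  have D0: "0 \<le> D r" for r
    unfolding D_def set_lebesgue_integral_def by (rule integral_nonneg_AE) (auto simp: g0)
  have Dz: "D 0 = 0" unfolding D_def by (rule set_integral_Icc_same)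
  let ?h = "\<lambda>r. g r * exp (- D r)"
  have h: "?h \<in> borel_measurable borel" "\<And>r. \<bar>?h r\<bar> \<le> C"
    using g0 gC D0 mult_mono[OF gC, of "exp (- D _)" 1] C0 by (auto simp: abs_mult)
  define F where "F = (\<lambda>t. exp (- D t) + (LINT r:{0..t}|lborel. ?h r))"
  have "F t = F 0"
  proof (rule constant_if_quadratic_increments[OF _ t])
    fix u v :: real assume uv: "0 \<le> u" "u \<le> v"
    define d where "d = (LINT r:{u<..v}|lborel. g r)"
    have d: "0 \<le> d" "d \<le> C * (v - u)" and Dv: "D v = D u + d"
      using increment_bounds[OF uv] integral_increment[OF uv] by (auto simp: d_def D_def)
    have gi: "set_integrable lborel {u<..v} g" and hi: "set_integrable lborel {u<..v} ?h"
      using g0 gC by (auto intro!: bounded_set_integrable[OF h, of "{u<..v}" u v]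
          bounded_set_integrable[OF gm, of C "{u<..v}" u v] simp del: greaterThanAtMost_subseteq_atLeastAtMost_iff)
    have ci: "set_integrable lborel {u<..v} (\<lambda>r. c * g r)" for c
      by (intro set_integrable_mult_right gi)
    have H: "(LINT r:{0..v}|lborel. ?h r) = (LINT r:{0..u}|lborel. ?h r) + (LINT r:{u<..v}|lborel. ?h r)"
      by (rule integral_Icc_split[OF h uv])
    have Dr: "D u \<le> D r \<and> D r \<le> D u + d" if "r \<in> {u<..v}" for r
      using that uv increment_bounds[of u r] increment_bounds[of r v] integral_increment[of u r]
        integral_increment[of r v] Dv by (auto simp: D_def)
    have "(LINT r:{u<..v}|lborel. ?h r) \<le> (LINT r:{u<..v}|lborel. exp (- D u) * g r)"
      by (rule set_integral_mono[OF hi ci])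
         (use Dr g0 in \<open>auto simp: mult.commute intro!: mult_left_mono\<close>)
    then have up: "(LINT r:{u<..v}|lborel. ?h r) \<le> exp (- D u) * d"
      by (simp add: d_def)
    have "(LINT r:{u<..v}|lborel. exp (- D u) * (1 - d) * g r) \<le> (LINT r:{u<..v}|lborel. ?h r)"
    proof (rule set_integral_mono[OF ci hi])
      fix r assume "r \<in> {u<..v}"
      from Dr[OF this] have "exp (- D u) * exp (- d) \<le> exp (- D r)" by (simp flip: exp_add)
      moreover have "1 - d \<le> exp (- d)" using exp_ge_add_one_self[of "- d"] by simp
      ultimately have "exp (- D u) * (1 - d) \<le> exp (- D r)"
        by (meson exp_ge_zero mult_left_mono order_trans)
      then show "exp (- D u) * (1 - d) * g r \<le> g r * exp (- D r)"
        using g0[of r] by (simp add: mult.commute mult_left_mono)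
    qed
    then have lo: "exp (- D u) * (1 - d) * d \<le> (LINT r:{u<..v}|lborel. ?h r)"
      by (simp add: d_def)
    have e: "1 - d \<le> exp (- d)" "exp (- d) \<le> 1 - d + d\<^sup>2"
    proof -
      show "1 - d \<le> exp (- d)" using exp_ge_add_one_self[of "- d"] by simp
      have "exp (- d) * (1 + d) \<le> exp (- d) * exp d"
        using exp_ge_add_one_self[of d] by (intro mult_left_mono) auto
      also have "\<dots> = 1" by (simp flip: exp_add)
      also have "1 \<le> (1 - d + d\<^sup>2) * (1 + d)"
        using d(1) by (simp add: algebra_simps power2_eq_square)
      finally show "exp (- d) \<le> 1 - d + d\<^sup>2" using d(1) by (simp add: mult_le_cancel_right)
    qed
    have "F v - F u = exp (- D u) * (exp (- d) - 1) + (LINT r:{u<..v}|lborel. ?h r)"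
      unfolding F_def Dv H by (simp add: algebra_simps exp_add[symmetric])
    moreover have "exp (- D u) * (exp (- d) - 1) + exp (- D u) * d \<le> 1 * d\<^sup>2"
      unfolding distrib_left[symmetric] using e D0 by (intro mult_mono) auto
    moreover have "exp (- D u) * (exp (- d) - 1) + exp (- D u) * (1 - d) * d \<ge> - d\<^sup>2"
    proof -
      have "exp (- D u) * (exp (- d) - 1) + exp (- D u) * (1 - d) * d
          = exp (- D u) * (exp (- d) - 1 + (1 - d) * d)" by (simp add: algebra_simps)
      also have "\<dots> \<ge> exp (- D u) * (- d\<^sup>2)"
        using e by (intro mult_left_mono) (auto simp: algebra_simps power2_eq_square)
      moreover have "exp (- D u) * d\<^sup>2 \<le> 1 * d\<^sup>2" using D0 by (intro mult_right_mono) auto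
      ultimately show ?thesis by simp
    qed
    ultimately have "\<bar>F v - F u\<bar> \<le> d\<^sup>2" using up lo by linarith
    also have "\<dots> \<le> (C * (v - u))\<^sup>2" using d by (intro power_mono) auto
    finally show "\<bar>F v - F u\<bar> \<le> C\<^sup>2 * (v - u)\<^sup>2" by (simp add: power_mult_distrib)
  qed
  moreover have "F 0 = 1" unfolding F_def by (simp only: Dz set_integral_Icc_same) simp
  ultimately show ?thesis by (simp add: F_def D_def)
qed

end

text \<open>
  Iterating the inequality, starting from an upper bound \<open>K\<close> of \<open>f\<close>, gives
  \<open>f t \<le> K (C t)\<^sup>n / n!\<close> for every \<open>n\<close>.
\<close>

lemma Gronwall_zero:
  fixes f :: "real \<Rightarrow> real"
  assumes cont: "continuous_on {0..T} f" and C: "0 \<le> C" and f0: "\<And>t. t \<in> {0..T} \<Longrightarrow> 0 \<le> f t"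
    and le: "\<And>t. t \<in> {0..T} \<Longrightarrow> f t \<le> (LINT r:{0..t}|lborel. C * f r)" and t: "t \<in> {0..T}"
  shows "f t = 0"
proof -
  have "bounded (f ` {0..T})" by (intro compact_imp_bounded compact_continuous_image cont) auto
  then obtain K where "\<forall>t\<in>{0..T}. \<bar>f t\<bar> \<le> K" by (auto simp: bounded_iff)
  then have K: "\<bar>f t\<bar> \<le> K" if "t \<in> {0..T}" for t using that by blast
  have K0: "0 \<le> K" using K[OF t] by simp
  have bound: "t \<in> {0..T} \<Longrightarrow> f t \<le> K * (C * t) ^ n / fact n" for n t
  proof (induction n arbitrary: t)
    case 0
    then show ?case using K[of t] by simp
  next
    case (Suc n)
    have cp: "continuous_on {0..t} (\<lambda>r. K * C ^ Suc n * r ^ n / fact n)" by (intro continuous_intros) simp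
    have "f t \<le> (LINT r:{0..t}|lborel. C * f r)" using le Suc by auto
    also have "\<dots> \<le> (LINT r:{0..t}|lborel. K * C ^ Suc n * r ^ n / fact n)"
    proof (rule set_integral_mono)
      show "set_integrable lborel {0..t} (\<lambda>r. C * f r)"
        using Suc.prems by (intro borel_integrable_atLeastAtMost' continuous_intros continuous_on_subset[OF cont]) auto
      show "set_integrable lborel {0..t} (\<lambda>r. K * C ^ Suc n * r ^ n / fact n)"
        by (rule borel_integrable_atLeastAtMost'[OF cp])
      fix r assume "r \<in> {0..t}"
      then have "C * f r \<le> C * (K * (C * r) ^ n / fact n)"
        using Suc.IH[of r] Suc.prems C by (intro mult_left_mono) auto
      then show "C * f r \<le> K * C ^ Suc n * r ^ n / fact n" by (simp add: power_mult_distrib mult_ac)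
    qed
    also have "\<dots> = K * C ^ Suc n * t ^ Suc n / fact (Suc n) - K * C ^ Suc n * 0 ^ Suc n / fact (Suc n)"
      unfolding set_lebesgue_integral_def real_scaleR_def mult.commute[of "indicat_real _ _"]
    proof (rule integral_FTC_Icc_real)
      show "0 \<le> t" using Suc.prems by simp
      fix x :: real
      have d: "((\<lambda>x. K * C ^ Suc n / fact (Suc n) * x ^ Suc n) has_real_derivative
          K * C ^ Suc n / fact (Suc n) * (real (Suc n) * x ^ n)) (at x)"
        by (rule DERIV_cong[OF DERIV_cmult[OF DERIV_pow]]) simp
      have e: "K * C ^ Suc n / fact (Suc n) * (real (Suc n) * x ^ n) = K * C ^ Suc n * x ^ n / fact n"
        by (simp add: fact_Suc del: power_Suc of_nat_Suc)
      from DERIV_cong[OF d e]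
      show "((\<lambda>x. K * C ^ Suc n * x ^ Suc n / fact (Suc n)) has_real_derivative K * C ^ Suc n * x ^ n / fact n) (at x)"
        by (simp only: times_divide_eq_left)
      show "isCont (\<lambda>x. K * C ^ Suc n * x ^ n / fact n) x" by (intro continuous_intros) simp
    qed
    also have "\<dots> = K * (C * t) ^ Suc n / fact (Suc n)" by (simp add: power_mult_distrib mult_ac)
    finally show ?case .
  qed
  have "(\<lambda>n. K * ((C * t) ^ n /\<^sub>R fact n)) \<longlonglongrightarrow> K * 0"
    by (intro tendsto_mult tendsto_const summable_LIMSEQ_zero summable_exp_generic)
  then have "f t \<le> K * 0"
  proof (rule LIMSEQ_le_const)
    have "f t \<le> K * ((C * t) ^ n /\<^sub>R fact n)" for n
      using bound[OF t, of n] by (simp add: divide_inverse algebra_simps)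
    then show "\<exists>N. \<forall>n\<ge>N. f t \<le> K * ((C * t) ^ n /\<^sub>R fact n)" by blast
  qed
  then show ?thesis using f0[OF t] by simp
qed

section \<open>Damping along characteristics\<close>

locale periodic_damping =
  fixes b :: "real \<Rightarrow> real \<Rightarrow> real" and C :: real
  assumes b_measurable: "(\<lambda>(s, t). b s t) \<in> borel_measurable \<Omega>_measure"
    and C_nonneg: "0 \<le> C"
    and b_bounds: "AE (s, t) in \<Omega>_measure. 0 \<le> b s t \<and> b s t \<le> C"
    and b_periodic: "AE (s, t) in \<Omega>_measure. b s (t + 1) = b s t"
begin

text \<open>
  A representative of the damping coefficient for which boundedness and periodicity, in both
  variables, hold at every point and not only almost everywhere.
\<close>

definition q :: "real \<Rightarrow> real \<Rightarrow> real" where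
  "q s r = max 0 (min C (per_ext (\<lambda>\<sigma>. b \<sigma> (frac r)) s))"

text \<open>
  The damping accumulated up to time \<open>t\<close> along the characteristic \<open>r \<mapsto> s - r\<close>. A particle that is
  at \<open>s\<close> initially is at \<open>s - t\<close> at time \<open>t\<close>, and its amplitude has then been multiplied by
  \<open>exp (- G t s)\<close>. Almost everywhere, the damping \<open>G 1\<close> of one period is the function \<open>a\<close>.
\<close>

definition G :: "real \<Rightarrow> real \<Rightarrow> real" where
  "G t s = (LINT r:{0..t}|lborel. q (s - r) r)"

text \<open>
  The solution of the transport equation by characteristics. The damping factor is
  applied before the rotation, so that norms can be computed by undoing the rotation; since \<open>G t\<close> is
  periodic, the factor at \<open>s\<close> is \<open>exp (- G t (s + t))\<close> after the rotation.
\<close>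

definition propagated :: "(real \<Rightarrow> complex) \<Rightarrow> real \<Rightarrow> real \<Rightarrow> complex" where
  "propagated x t = T0 t (\<lambda>s. complex_of_real (exp (- G t s)) * x s)"

lemma per_b_measurable [measurable (raw)]:
  assumes "f \<in> borel_measurable M" "g \<in> borel_measurable M"
  shows "(\<lambda>x. per_ext (\<lambda>s. b s (g x)) (f x)) \<in> borel_measurable M"
proof -
  have [simp]: "{0<..<1::real} \<times> (UNIV :: real set) \<in> sets borel"
    by (intro borel_open open_Times) auto
  have "(\<lambda>p. indicator ({0<..<1} \<times> UNIV) p *\<^sub>R (case p of (s, t) \<Rightarrow> b s t)) \<in> borel_measurable lborel"
    using b_measurable by (subst (asm) borel_measurable_restrict_space_iff) auto
  moreover have "(\<lambda>p. indicator ({0<..<1} \<times> UNIV) p *\<^sub>R (case p of (s, t) \<Rightarrow> b s t))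
      = (\<lambda>p. if fst p \<in> {0<..<1} then b (fst p) (snd p) else 0)"
    by (rule ext) (auto split: split_indicator)
  ultimately have "(\<lambda>p. if fst p \<in> {0<..<1} then b (fst p) (snd p) else 0) \<in> borel_measurable (borel \<Otimes>\<^sub>M borel)"
    by (simp only: borel_prod measurable_lborel2)
  from measurable_compose[OF measurable_Pair[OF measurable_compose[OF assms(1) borel_measurable_frac] assms(2)] this]
  show ?thesis by (simp only: per_ext_cut fst_conv snd_conv)
qed

lemma q_measurable [measurable (raw)]:
  assumes [measurable]: "f \<in> borel_measurable M" "g \<in> borel_measurable M"
  shows "(\<lambda>x. q (f x) (g x)) \<in> borel_measurable M"
proof -
  have [measurable]: "(\<lambda>x. frac (g x)) \<in> borel_measurable M"
    by (rule measurable_compose[OF assms(2) borel_measurable_frac])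
  show ?thesis unfolding q_def by measurable
qed

lemma q_nonneg: "0 \<le> q s r" and q_le: "q s r \<le> C" and q_abs: "\<bar>q s r\<bar> \<le> C"
  using C_nonneg by (auto simp: q_def)

lemma q_cong_frac: "frac s = frac s' \<Longrightarrow> frac r = frac r' \<Longrightarrow> q s r = q s' r'"
  unfolding q_def per_ext_def by simp

lemma G_measurable [measurable (raw)]:
  assumes [measurable]: "f \<in> borel_measurable M" "g \<in> borel_measurable M"
  shows "(\<lambda>x. G (f x) (g x)) \<in> borel_measurable M"
proof -
  have "G t s = (LINT r|lborel. (if 0 \<le> r \<and> r \<le> t then q (s - r) r else 0))" for t s
    unfolding G_def set_lebesgue_integral_def by (intro Bochner_Integration.integral_cong) auto
  then show ?thesis by simp
qed

lemma G_nonneg: "0 \<le> G t s"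
  unfolding G_def set_lebesgue_integral_def by (rule integral_nonneg_AE) (auto simp: q_nonneg)

lemma G_0 [simp]: "G 0 s = 0"
  unfolding G_def by (rule set_integral_Icc_same)

lemma G_increment:
  assumes "0 \<le> u" "u \<le> v"
  shows "G v s = G u s + (LINT r:{u<..v}|lborel. q (s - r) r)"
  unfolding G_def by (rule integral_increment[OF _ q_nonneg q_le assms]) measurable

lemma G_mono: "0 \<le> u \<Longrightarrow> u \<le> v \<Longrightarrow> G u s \<le> G v s"
  and G_Lipschitz: "0 \<le> u \<Longrightarrow> u \<le> v \<Longrightarrow> G v s \<le> G u s + C * (v - u)"
  using G_increment[of u v s] increment_bounds[of "\<lambda>r. q (s - r) r" C u v]
  by (auto simp: q_nonneg q_le)

lemma G_frac: "G t (frac s) = G t s"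
proof -
  have "q (frac s - r) r = q (s - r) r" for r
    by (rule q_cong_frac) (use frac_frac_add[of s "- r"] in auto)
  then show ?thesis by (simp add: G_def)
qed

text \<open>
  Along a characteristic the damping rate \<open>r \<mapsto> q (s - r) r\<close> has period 1, since \<open>q\<close> has period 1 in
  space and in time.
\<close>

lemma G_add_one:
  assumes "0 \<le> t" shows "G (t + 1) s = G t s + G 1 s"
proof -
  have q1: "q (s - (r + 1)) (r + 1) = q (s - r) r" for r
  proof (rule q_cong_frac)
    show "frac (s - (r + 1)) = frac (s - r)"
      by (metis add_diff_eq diff_diff_eq diff_add_cancel frac_1_eq)
    show "frac (r + 1) = frac r" by (rule frac_1_eq)
  qed
  have "(LINT r:{1<..t + 1}|lborel. q (s - r) r) = (LINT r|lborel. indicator {1<..t + 1} (1 + r) *\<^sub>R q (s - (1 + r)) (1 + r))"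
    unfolding set_lebesgue_integral_def
    using lborel_integral_real_affine[of 1 "\<lambda>r. indicator {1<..t + 1} r *\<^sub>R q (s - r) r" 1] by simp
  also have "\<dots> = (LINT r:{0<..t}|lborel. q (s - r) r)"
    unfolding set_lebesgue_integral_def
    by (intro Bochner_Integration.integral_cong) (auto simp: q1[unfolded add.commute[of _ "1::real"]] split: split_indicator)
  finally show ?thesis
    using G_increment[of 1 "t + 1" s] G_increment[of 0 t s] assms by simp
qed

lemma G_of_nat: "G (real n) s = real n * G 1 s"
proof (induction n)
  case (Suc n)
  then show ?case using G_add_one[of "real n" s] by (simp add: algebra_simps)
qed simp

text \<open>
  The accumulated damping differs from its linear growth \<open>t a\<close> by at most the damping of one
  period. These two bounds contain all the asymptotics: \<open>G t\<close> vanishes where \<open>a\<close> does, and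
  elsewhere \<open>exp (- G t)\<close> decays like \<open>exp (- t a)\<close>.
\<close>

lemma G_linear_bounds:
  assumes t: "0 \<le> t"
  shows "(t - 1) * G 1 s \<le> G t s" "G t s \<le> (t + 1) * G 1 s"
proof -
  define n where "n = nat \<lfloor>t\<rfloor>"
  have n: "real n \<le> t" "t \<le> real (Suc n)" using t by (auto simp: n_def) linarith+
  have "(t - 1) * G 1 s \<le> real n * G 1 s" using n G_nonneg by (intro mult_right_mono) auto
  also have "\<dots> = G (real n) s" by (simp add: G_of_nat)
  also have "\<dots> \<le> G t s" using n by (intro G_mono) auto
  finally show "(t - 1) * G 1 s \<le> G t s" .
  have "G t s \<le> G (real (Suc n)) s" using n t by (intro G_mono) auto
  also have "\<dots> = real (Suc n) * G 1 s" by (rule G_of_nat)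
  also have "\<dots> \<le> (t + 1) * G 1 s" using n G_nonneg by (intro mult_right_mono) auto
  finally show "G t s \<le> (t + 1) * G 1 s" .
qed

lemma exp_G_primitive:
  assumes "0 \<le> t"
  shows "(LINT r:{0..t}|lborel. q (s - r) r * exp (- G r s)) = 1 - exp (- G t s)"
proof -
  have 1: "(\<lambda>r. q (s - r) r) \<in> borel_measurable borel" by measurable
  have 2: "(\<lambda>t. G t s) \<in> borel_measurable borel" by measurable
  show ?thesis
    using integral_exp_primitive[OF 1 q_nonneg q_le 2[unfolded G_def] assms] by (simp only: G_def)
qed

lemma AE_sections:
  assumes "AE (s, t) in \<Omega>_measure. P s t"
  shows "AE s in unit_measure. AE t in lborel. P s t"
proof -
  have "{0<..<1::real} \<times> (UNIV :: real set) \<in> sets borel"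
    by (intro borel_open open_Times) auto
  then have "AE p in lborel. p \<in> {0<..<1} \<times> UNIV \<longrightarrow> P (fst p) (snd p)"
    using assms by (simp add: AE_restrict_space_iff case_prod_beta')
  then have "AE s in lborel. AE t in lborel. s \<in> {0<..<1} \<longrightarrow> P s t"
    unfolding lborel_prod[symmetric] by (drule_tac lborel_pair.AE_pair) auto
  then show ?thesis by (auto simp: AE_restrict_space_iff)
qed

lemma b_section_measurable:
  assumes s: "s \<in> {0<..<1}" shows "b s \<in> borel_measurable borel"
proof -
  have "(\<lambda>r. per_ext (\<lambda>\<sigma>. b \<sigma> r) s) = b s"
    using per_ext_unit[OF s] by (intro ext)
  moreover have "(\<lambda>r. per_ext (\<lambda>\<sigma>. b \<sigma> r) s) \<in> borel_measurable borel"
    by measurable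
  ultimately show ?thesis by (simp only:)
qed

text \<open>
  Periodicity almost everywhere is known for a shift by one. On almost every line it holds at all
  integer translates of almost every point, which gives \<open>b s r = b s (frac r)\<close>.
\<close>

lemma b_eq_q: "AE s in unit_measure. AE r in lborel. b s r = q s r"
proof -
  have "AE s in unit_measure. s \<in> {0<..<1}"
    using AE_space[of unit_measure] by (simp add: space_restrict_space)
  with AE_sections[OF b_bounds] AE_sections[OF b_periodic] show ?thesis
  proof eventually_elim
    case (elim s)
    note [measurable] = b_section_measurable[OF elim(3)]
    have "AE r in lborel. b s (of_int k + 1 * r + 1) = b s (of_int k + 1 * r)" for k :: int
      by (rule AE_borel_affine) (use elim(2) in \<open>auto simp: pred_def\<close>)
    then have "AE r in lborel. \<forall>k::int. b s (of_int k + r + 1) = b s (of_int k + r)"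
      by (simp add: AE_all_countable)
    with elim(1) show ?case
    proof eventually_elim
      case (elim r)
      have "b s (of_int k + r) = b s r" for k
      proof (induction k rule: int_induct[where k = 0])
        case base
        then show ?case by simp
      next
        case (step1 i)
        then show ?case using elim(2)[rule_format, of i] by (simp add: algebra_simps)
      next
        case (step2 i)
        then show ?case using elim(2)[rule_format, of "i - 1"] by (simp add: algebra_simps)
      qed
      from this[of "- \<lfloor>r\<rfloor>"] have "b s (frac r) = b s r" by (simp add: frac_def)
      moreover have "per_ext (\<lambda>\<sigma>. b \<sigma> (frac r)) s = b s (frac r)"
        using \<open>s \<in> {0<..<1}\<close> by (rule per_ext_unit)
      ultimately show ?case using elim(1) by (simp add: q_def)
    qed
  qed
qed

lemma per_b_eq_q: "AE r in lborel. AE s in unit_measure. per_ext (\<lambda>\<sigma>. b \<sigma> r) s = q s r"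
proof -
  interpret U: finite_measure unit_measure by (rule finite_measure_unit)
  interpret UL: pair_sigma_finite unit_measure "lborel :: real measure" ..
  have [measurable]: "(\<lambda>p. fst p) \<in> borel_measurable (unit_measure \<Otimes>\<^sub>M (lborel :: real measure))"
    by (rule measurable_compose[OF measurable_fst measurable_restrict_space1]) simp
  have [measurable]: "(\<lambda>p. snd p) \<in> borel_measurable (unit_measure \<Otimes>\<^sub>M (lborel :: real measure))"
    by (rule measurable_compose[OF measurable_snd]) simp
  have "AE s in unit_measure. s \<in> {0<..<1}"
    using AE_space[of unit_measure] by (simp add: space_restrict_space)
  with b_eq_q have "AE s in unit_measure. AE r in lborel. per_ext (\<lambda>\<sigma>. b \<sigma> r) s = q s r"
    by eventually_elim (simp add: per_ext_unit)
  then show ?thesis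
    by (subst (asm) UL.AE_commute) (rule borel_measurable_eq, measurable)
qed

lemma per_b_eq_q_shifted:
  "AE r in lborel. AE s in unit_measure. per_ext (\<lambda>\<sigma>. b \<sigma> r) (s + \<tau> r) = q (s + \<tau> r) r"
  using per_b_eq_q
proof eventually_elim
  case (elim r)
  from AE_unit_shift[OF elim, of "\<tau> r"] show ?case
  proof eventually_elim
    case (elim s)
    have "per_ext (\<lambda>\<sigma>. b \<sigma> r) (frac (s + \<tau> r)) = per_ext (\<lambda>\<sigma>. b \<sigma> r) (s + \<tau> r)"
      by (simp add: per_ext_def)
    moreover have "q (frac (s + \<tau> r)) r = q (s + \<tau> r) r" by (rule q_cong_frac) auto
    ultimately show ?case using elim by simp
  qed
qed

text \<open>
  On almost every characteristic \<open>q\<close> agrees with \<open>b\<close> almost everywhere: for fixed \<open>r\<close> the change of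
  variable \<open>s \<mapsto> s + \<tau> r\<close> is a rotation, and Fubini's theorem exchanges the order of the
  quantifiers.
\<close>

lemma per_b_eq_q_lines:
  assumes [measurable]: "\<tau> \<in> borel_measurable borel"
  shows "AE s in unit_measure. AE r in lborel. per_ext (\<lambda>\<sigma>. b \<sigma> r) (s + \<tau> r) = q (s + \<tau> r) r"
proof -
  interpret U: finite_measure unit_measure by (rule finite_measure_unit)
  interpret UL: pair_sigma_finite unit_measure "lborel :: real measure" ..
  have [measurable]: "(\<lambda>p. fst p) \<in> borel_measurable (unit_measure \<Otimes>\<^sub>M (lborel :: real measure))"
    by (rule measurable_compose[OF measurable_fst measurable_restrict_space1]) simp
  have [measurable]: "(\<lambda>p. snd p) \<in> borel_measurable (unit_measure \<Otimes>\<^sub>M (lborel :: real measure))"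
    by (rule measurable_compose[OF measurable_snd]) simp
  show ?thesis
    using per_b_eq_q_shifted[of \<tau>] by (subst UL.AE_commute) (rule borel_measurable_eq, measurable)
qed

lemma damping_eq_G: "AE s in unit_measure. damping b s = G 1 s"
proof -
  have "(\<lambda>r::real. - r) \<in> borel_measurable borel" by simp
  from per_b_eq_q_lines[OF this] show ?thesis
  proof eventually_elim
    case (elim s)
    then have *: "AE r in lborel. per_ext (\<lambda>\<sigma>. b \<sigma> r) (s - r) = q (s - r) r" by simp
    show "damping b s = G 1 s"
      unfolding damping_def G_def set_lebesgue_integral_def
    proof (rule integral_cong_AE)
      show "AE r in lborel. indicator {0..1} r *\<^sub>R per_ext (\<lambda>\<sigma>. b \<sigma> r) (s - r) = indicator {0..1} r *\<^sub>R q (s - r) r"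
        using * by eventually_elim simp
    qed measurable
  qed
qed

lemma damping_measurable: "damping b \<in> borel_measurable borel"
  unfolding damping_def set_lebesgue_integral_def by measurable

end

section \<open>Existence and uniqueness of mild solutions\<close>

context periodic_damping
begin

lemma propagated_eq:
  "propagated x t s = complex_of_real (exp (- G t (s + t))) * T0 t x s"
  by (auto simp: propagated_def T0_def per_ext_def G_frac)

lemma damped_propagator_sqint:
  assumes x: "sqint unit_measure x" shows "sqint unit_measure (\<lambda>s. complex_of_real (exp (- G t s)) * x s)"
proof (rule sqint_bound_AE[OF x, of _ 1])
  have [measurable]: "x \<in> borel_measurable unit_measure" using x by (rule sqint_measurable)
  have [measurable]: "(\<lambda>s. G t s) \<in> borel_measurable unit_measure"
    by (rule measurable_restrict_space1) measurable
  show "(\<lambda>s. complex_of_real (exp (- G t s)) * x s) \<in> borel_measurable unit_measure" by measurable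
  show "AE s in unit_measure. cmod (complex_of_real (exp (- G t s)) * x s) \<le> 1 * cmod (x s)"
    by (auto simp: norm_mult G_nonneg intro!: mult_left_le_one_le)
qed

lemma propagated_sqint: "sqint unit_measure x \<Longrightarrow> sqint unit_measure (propagated x t)"
  unfolding propagated_def using damped_propagator_sqint[of x t]
  by (simp add: sqint_T0_iff sqint_measurable)

lemma B_B_eq: "B b r (B b r y) s = complex_of_real \<bar>b s r\<bar> * y s"
proof -
  have "B b r (B b r y) s = complex_of_real (sqrt (b s r) * sqrt (b s r)) * y s"
    by (simp only: B_def of_real_mult mult.assoc)
  then show ?thesis by (simp only: real_sqrt_mult_self)
qed

text \<open>
  On the trajectory \<open>propagated x\<close> the integrand of the mild formulation is an essentially
  bounded function of \<open>(r, s)\<close> times \<open>T0 t x\<close>, which is independent of \<open>r\<close>: particles that are at \<open>s\<close> at time \<open>t\<close> come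
  from the same point. The absolute value appears since \<open>sqrt\<close> is extended to negative numbers as an
  odd function.
\<close>

lemma integrand_eq:
  "T0 (t - r) (B b r (B b r (propagated x r))) s
    = complex_of_real (\<bar>per_ext (\<lambda>\<sigma>. b \<sigma> r) (s + (t - r))\<bar> * exp (- G r (s + t))) * T0 t x s"
proof (cases "frac (s + (t - r)) = 0")
  case True
  then show ?thesis by (simp add: T0_def per_ext_def)
next
  case False
  have "frac (frac (s + (t - r)) + r) = frac (s + t)" by (simp add: frac_frac_add)
  then have "T0 r x (frac (s + (t - r))) = T0 t x s" and "G r (frac (s + (t - r)) + r) = G r (s + t)"
    using G_frac[of r "frac (s + (t - r)) + r"] G_frac[of r "s + t"]
    by (auto simp: T0_def per_ext_def simp del: frac_eq_0_iff)
  then show ?thesis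
    using False by (simp add: T0_def[of "t - r"] per_ext_def[of _ "s + (t - r)"] B_B_eq propagated_eq del: frac_eq_0_iff)
qed

text \<open>
  Changing the time from \<open>t\<close> to \<open>r\<close> changes the damping factor by at most \<open>C \<bar>r - t\<bar>\<close> and
  rotates the data; the latter is strongly continuous.
\<close>

lemma propagated_continuous:
  assumes x: "sqint unit_measure x" and t: "0 \<le> t"
  shows "((\<lambda>r. L2_dist (propagated x r) (propagated x t)) \<longlongrightarrow> 0) (at t within {0..})"
proof -
  let ?y = "\<lambda>t s. complex_of_real (exp (- G t s)) * x s"
  note y = damped_propagator_sqint[OF x]
  have Ty: "sqint unit_measure (T0 u (?y v))" for u v
    using y[of v] by (simp add: sqint_T0_iff sqint_measurable)
  have le: "L2_dist (propagated x r) (propagated x t)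
      \<le> C * \<bar>r - t\<bar> * norm2 unit_measure x + L2_dist (T0 r (?y t)) (T0 t (?y t))" if "0 \<le> r" for r
  proof -
    have "L2_dist (propagated x r) (propagated x t)
        \<le> L2_dist (T0 r (?y r)) (T0 r (?y t)) + L2_dist (T0 r (?y t)) (T0 t (?y t))"
      unfolding propagated_def L2_dist_norm2 by (rule norm2_triangle_diff[OF Ty Ty Ty])
    also have "L2_dist (T0 r (?y r)) (T0 r (?y t)) = L2_dist (?y r) (?y t)"
      by (rule T0_isometric; rule sqint_measurable[OF y])
    also have "\<dots> \<le> C * \<bar>r - t\<bar> * norm2 unit_measure x"
      unfolding L2_dist_norm2
    proof (rule norm2_mono_AE[OF x])
      show "(\<lambda>s. ?y r s - ?y t s) \<in> borel_measurable unit_measure"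
        by (intro borel_measurable_diff sqint_measurable[OF y])
      have "\<bar>exp (- G r s) - exp (- G t s)\<bar> \<le> C * \<bar>r - t\<bar>" for s
      proof -
        have e: "\<bar>exp (- u) - exp (- v)\<bar> \<le> \<bar>u - v\<bar>" if "0 \<le> u" "0 \<le> v" for u v :: real
        proof -
          have "exp (- u) - exp (- v) \<le> v - u" if "0 \<le> u" "u \<le> v" for u v :: real
          proof -
            have "exp (- v) \<ge> exp (- u) * (1 - (v - u))"
            proof -
              have "1 - (v - u) \<le> exp (u - v)" using exp_ge_add_one_self[of "u - v"] by linarith
              then have "exp (- u) * (1 - (v - u)) \<le> exp (- u) * exp (u - v)"
                by (intro mult_left_mono) auto
              then show ?thesis by (simp flip: exp_add)
            qed
            moreover have "exp (- u) * (v - u) \<le> 1 * (v - u)" using that by (intro mult_right_mono) auto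
            ultimately show ?thesis by (simp add: algebra_simps)
          qed
          from this[of u v] this[of v u] that show ?thesis by (cases "u \<le> v") (auto simp: abs_if)
        qed
        have "\<bar>G r s - G t s\<bar> \<le> C * \<bar>r - t\<bar>"
          using G_mono[of r t s] G_mono[of t r s] G_Lipschitz[of r t s] G_Lipschitz[of t r s] that t
          by (cases "r \<le> t") (auto simp: abs_if algebra_simps)
        then show ?thesis using e[OF G_nonneg G_nonneg, of r s t s] by linarith
      qed
      then show "AE s in unit_measure. cmod (?y r s - ?y t s) \<le> C * \<bar>r - t\<bar> * cmod (x s)"
        by (auto simp: norm_mult simp flip: left_diff_distrib of_real_diff intro!: mult_right_mono)
      show "0 \<le> C * \<bar>r - t\<bar>" using C_nonneg by simp
    qed
    finally show ?thesis by simp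
  qed
  have "((\<lambda>r. C * \<bar>r - t\<bar> * norm2 unit_measure x + L2_dist (T0 r (?y t)) (T0 t (?y t)))
      \<longlongrightarrow> C * \<bar>t - t\<bar> * norm2 unit_measure x + 0) (at t within {0..})"
    by (intro tendsto_intros tendsto_within_subset[OF T0_strongly_continuous[OF y]]) auto
  then have lim: "((\<lambda>r. C * \<bar>r - t\<bar> * norm2 unit_measure x + L2_dist (T0 r (?y t)) (T0 t (?y t)))
      \<longlongrightarrow> 0) (at t within {0..})" by simp
  show ?thesis
  proof (rule tendsto_sandwich[OF always_eventually _ tendsto_const lim])
    show "\<forall>\<^sub>F r in at t within {0..}. L2_dist (propagated x r) (propagated x t)
        \<le> C * \<bar>r - t\<bar> * norm2 unit_measure x + L2_dist (T0 r (?y t)) (T0 t (?y t))"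
      by (rule eventually_at_filter[THEN iffD2]) (use le in \<open>auto intro: always_eventually\<close>)
  qed (simp add: L2_dist_norm2)
qed

text \<open>
  By the lemma \<open>integrand_eq\<close> the pointwise integral of the mild formulation is, for almost every
  \<open>s\<close>, the product of \<open>T0 t x s\<close> and \<open>\<integral> q (\<sigma> - r) r exp (- G r \<sigma>) dr = 1 - exp (- G t \<sigma>)\<close>
  over \<open>[0,t]\<close>, with \<open>\<sigma> = s + t\<close>.
\<close>

theorem mild_solution_propagated:
  assumes x: "sqint unit_measure x"
  shows "mild_solution b x (propagated x)"
  unfolding mild_solution_def
proof (intro conjI allI impI)
  fix t :: real assume t: "0 \<le> t"
  show "propagated x t \<in> L2_space" using propagated_sqint[OF x] by (simp add: L2_space_sqint)
  show "((\<lambda>r. L2_dist (propagated x r) (propagated x t)) \<longlongrightarrow> 0) (at t within {0..})"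
    by (rule propagated_continuous[OF x t])
  let ?N = "restrict_space lborel {0..t}"
  let ?f = "\<lambda>r. T0 (t - r) (B b r (B b r (propagated x r)))"
  have At: "{0..t} \<in> sets borel" "emeasure lborel {0..t} < \<infinity>"
    using t by auto
  note finN = finite_measure_restrict[OF At]
  interpret N: finite_measure ?N by (rule finN)
  interpret U: finite_measure unit_measure by (rule finite_measure_unit)
  interpret NU: pair_sigma_finite ?N unit_measure ..
  have Tx: "sqint unit_measure (T0 t x)" using x by (simp add: sqint_T0_iff sqint_measurable)
  have [measurable]: "(\<lambda>p. fst p) \<in> borel_measurable (?N \<Otimes>\<^sub>M unit_measure)"
    "(\<lambda>p. snd p) \<in> borel_measurable (?N \<Otimes>\<^sub>M unit_measure)"
    "(\<lambda>r. r) \<in> borel_measurable ?N" "(\<lambda>s. s) \<in> borel_measurable unit_measure"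
    by (auto intro!: measurable_compose[OF measurable_fst] measurable_compose[OF measurable_snd] measurable_restrict_space1)
  have [measurable]: "T0 t x \<in> borel_measurable borel"
    by (rule borel_measurable_T0[OF sqint_measurable[OF x]])
  have AErs: "AE r in ?N. AE s in unit_measure. per_ext (\<lambda>\<sigma>. b \<sigma> r) (s + (t - r)) = q (s + (t - r)) r"
    using per_b_eq_q_shifted[of "\<lambda>r. t - r"] by (auto simp: AE_restrict_space_iff elim: eventually_mono)
  have set_meas: "{p \<in> space (?N \<Otimes>\<^sub>M unit_measure). per_ext (\<lambda>\<sigma>. b \<sigma> (fst p)) (snd p + (t - fst p)) = q (snd p + (t - fst p)) (fst p)}
      \<in> sets (?N \<Otimes>\<^sub>M unit_measure)"
    by (rule borel_measurable_eq; measurable)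
  have AEp: "AE p in ?N \<Otimes>\<^sub>M unit_measure. per_ext (\<lambda>\<sigma>. b \<sigma> (fst p)) (snd p + (t - fst p)) = q (snd p + (t - fst p)) (fst p)"
    by (rule NU.AE_pair_measure[OF set_meas]) (use AErs in simp)
  have AEsr: "AE s in unit_measure. AE r in ?N. per_ext (\<lambda>\<sigma>. b \<sigma> r) (s + (t - r)) = q (s + (t - r)) r"
    using AErs NU.AE_commute[OF set_meas] by simp
  have sq: "sqint (?N \<Otimes>\<^sub>M unit_measure) (\<lambda>(r, s). ?f r s)"
    unfolding integrand_eq case_prod_beta'
  proof (rule sqint_bound_AE[OF sqint_snd[OF finN finite_measure_unit Tx], of _ C])
    show "AE p in ?N \<Otimes>\<^sub>M unit_measure. cmod (complex_of_real
        (\<bar>per_ext (\<lambda>\<sigma>. b \<sigma> (fst p)) (snd p + (t - fst p))\<bar> * exp (- G (fst p) (snd p + t))) * T0 t x (snd p))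
        \<le> C * cmod (T0 t x (snd p))"
      using AEp
    proof eventually_elim
      case (elim p)
      have "\<bar>per_ext (\<lambda>\<sigma>. b \<sigma> (fst p)) (snd p + (t - fst p))\<bar> * exp (- G (fst p) (snd p + t)) \<le> C * 1"
        unfolding elim by (intro mult_mono q_abs) (auto simp: G_nonneg C_nonneg)
      then show ?case
        by (simp add: norm_mult abs_mult mult_right_mono)
    qed
  qed measurable
  let ?y = "\<lambda>s. LINT r:{0..t}|lborel. ?f r s"
  have "AE s in unit_measure. propagated x t s = T0 t x s - ?y s"
    using AEsr
  proof eventually_elim
    case (elim s)
    have "?y s = (LINT r|?N. ?f r s)" by (rule set_integral_eq_restrict[OF At])
    also have "\<dots> = (LINT r|?N. complex_of_real (q (s + t - r) r * exp (- G r (s + t))) * T0 t x s)"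
    proof (rule integral_cong_AE)
      show "AE r in ?N. ?f r s = complex_of_real (q (s + t - r) r * exp (- G r (s + t))) * T0 t x s"
        using elim by eventually_elim (simp add: integrand_eq q_nonneg add_diff_eq)
    qed (simp_all only: integrand_eq, measurable)
    also have "\<dots> = complex_of_real (LINT r|?N. q (s + t - r) r * exp (- G r (s + t))) * T0 t x s"
      by (simp only: integral_mult_left_zero integral_complex_of_real)
    also have "(LINT r|?N. q (s + t - r) r * exp (- G r (s + t))) = 1 - exp (- G t (s + t))"
      using exp_G_primitive[OF t, of "s + t"] by (simp add: set_integral_eq_restrict[OF At])
    finally show ?case by (simp add: propagated_eq[of x t s] algebra_simps)
  qed
  then show "\<exists>y. has_L2_bochner_integral {0..t} ?f y \<and> (AE s in unit_measure. propagated x t s = T0 t x s - y s)"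
    using has_L2_bochner_integral_jointly[OF At sq] by blast
qed

lemma B_B_measurable:
  assumes "y \<in> borel_measurable unit_measure" shows "B b r (B b r y) \<in> borel_measurable unit_measure"
proof -
  have "(\<lambda>s. per_ext (\<lambda>\<sigma>. b \<sigma> r) s) \<in> borel_measurable unit_measure"
    by (rule measurable_restrict_space1) measurable
  moreover have "per_ext (\<lambda>\<sigma>. b \<sigma> r) s = b s r" if "s \<in> space unit_measure" for s
    using that by (intro per_ext_unit) (simp add: space_restrict_space)
  ultimately have [measurable]: "(\<lambda>s. b s r) \<in> borel_measurable unit_measure"
    by (subst measurable_cong[symmetric]) auto
  show ?thesis using assms unfolding B_B_eq[abs_def] by measurable
qed

lemma B_B_Lipschitz:
  "AE r in lborel. \<forall>y z. sqint unit_measure y \<longrightarrow> sqint unit_measure z \<longrightarrow>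
     L2_dist (B b r (B b r y)) (B b r (B b r z)) \<le> C * L2_dist y z"
  using per_b_eq_q
proof eventually_elim
  case (elim r)
  have "AE s in unit_measure. s \<in> {0<..<1}"
    using AE_space[of unit_measure] by (simp add: space_restrict_space)
  with elim have bC: "AE s in unit_measure. \<bar>b s r\<bar> \<le> C"
    by eventually_elim (use q_abs in \<open>simp add: per_ext_unit\<close>)
  show ?case
  proof (intro allI impI)
    fix y z assume yz: "sqint unit_measure y" "sqint unit_measure z"
    show "L2_dist (B b r (B b r y)) (B b r (B b r z)) \<le> C * L2_dist y z"
      unfolding L2_dist_norm2
    proof (rule norm2_mono_AE[OF sqint_diff[OF yz] _ _ C_nonneg])
      show "(\<lambda>s. B b r (B b r y) s - B b r (B b r z) s) \<in> borel_measurable unit_measure"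
        using yz by (intro borel_measurable_diff B_B_measurable sqint_measurable)
      show "AE s in unit_measure. cmod (B b r (B b r y) s - B b r (B b r z) s) \<le> C * cmod (y s - z s)"
        using bC by eventually_elim
          (auto simp: B_B_eq norm_mult mult_right_mono simp flip: right_diff_distrib)
    qed
  qed
qed

text \<open>
  The distance \<open>f\<close> of two mild solutions is continuous, and since rotations are isometries and
  \<open>B B\<^sup>*\<close> is Lipschitz with constant \<open>C\<close> it satisfies \<open>f u \<le> \<integral> C f\<close> over \<open>[0,u]\<close>.
\<close>

theorem mild_solution_unique:
  assumes w: "mild_solution b x w" and z: "mild_solution b x z" and t: "0 \<le> t"
  shows "AE s in unit_measure. w t s = z t s"
proof -
  have wz: "sqint unit_measure (w r)" "sqint unit_measure (z r)" if "0 \<le> r" for r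
    using w z that by (auto simp: mild_solution_def L2_space_sqint)
  define f where "f = (\<lambda>r. L2_dist (w r) (z r))"
  have cont: "continuous_on {0..} f"
    unfolding continuous_on_def
  proof
    fix u :: real assume u: "u \<in> {0..}"
    have "((\<lambda>r. L2_dist (w r) (w u) + L2_dist (z r) (z u)) \<longlongrightarrow> 0 + 0) (at u within {0..})"
      using w z u by (intro tendsto_add) (auto simp: mild_solution_def)
    then have lim: "((\<lambda>r. L2_dist (w r) (w u) + L2_dist (z r) (z u)) \<longlongrightarrow> 0) (at u within {0..})"
      by simp
    have "((\<lambda>r. f r - f u) \<longlongrightarrow> 0) (at u within {0..})"
    proof (rule Lim_null_comparison[OF _ lim])
      show "\<forall>\<^sub>F r in at u within {0..}. norm (f r - f u) \<le> L2_dist (w r) (w u) + L2_dist (z r) (z u)"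
      proof (rule eventually_at_filter[THEN iffD2], intro always_eventually allI impI)
        fix r :: real assume r: "r \<in> {0..}"
        have tri: "L2_dist p p' \<le> L2_dist p p'' + L2_dist p'' p'"
          if "sqint unit_measure p" "sqint unit_measure p'" "sqint unit_measure p''" for p p' p''
          unfolding L2_dist_norm2 by (rule norm2_triangle_diff[OF that(1,3,2)])
        have sym: "L2_dist p p' = L2_dist p' p" for p p'
          unfolding L2_dist_norm2 by (rule norm2_minus_commute)
        have q: "sqint unit_measure (w r)" "sqint unit_measure (z r)" "sqint unit_measure (w u)" "sqint unit_measure (z u)"
          using wz r u by auto
        show "norm (f r - f u) \<le> L2_dist (w r) (w u) + L2_dist (z r) (z u)"
          using tri[of "w r" "z r" "w u"] tri[of "w u" "z r" "z u"] tri[of "w u" "z u" "w r"] tri[of "w r" "z u" "z r"]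
            sym[of "w u" "w r"] sym[of "z u" "z r"] q
          by (simp add: f_def abs_le_iff)
      qed
    qed
    then show "(f \<longlongrightarrow> f u) (at u within {0..})" by (rule LIM_zero_cancel)
  qed
  have "f t = 0"
  proof (rule Gronwall_zero[of t f C])
    show contt: "continuous_on {0..t} f" by (rule continuous_on_subset[OF cont]) auto
    show "0 \<le> f u" for u by (simp add: f_def L2_dist_norm2)
    fix u assume u: "u \<in> {0..t}"
    have Au: "{0..u} \<in> sets borel" "emeasure lborel {0..u} < \<infinity>" using u by auto
    from w u obtain y where y: "has_L2_bochner_integral {0..u} (\<lambda>r. T0 (u - r) (B b r (B b r (w r)))) y"
      and wy: "AE s in unit_measure. w u s = T0 u x s - y s" by (auto simp: mild_solution_def)
    from z u obtain y' where y': "has_L2_bochner_integral {0..u} (\<lambda>r. T0 (u - r) (B b r (B b r (z r)))) y'"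
      and zy: "AE s in unit_measure. z u s = T0 u x s - y' s" by (auto simp: mild_solution_def)
    have ys: "sqint unit_measure y" "sqint unit_measure y'"
      using y y' by (auto simp: has_L2_bochner_integral_def L2_space_sqint)
    have "f u = L2_dist y' y"
      unfolding f_def L2_dist_norm2
    proof (rule norm2_cong_AE)
      show "AE s in unit_measure. w u s - z u s = y' s - y s"
        using wy zy by eventually_elim simp
    qed (use wz u ys in \<open>auto intro!: sqint_measurable sqint_diff\<close>)
    also have "\<dots> = L2_dist y y'" unfolding L2_dist_norm2 by (rule norm2_minus_commute)
    also have "\<dots> \<le> (LINT r:{0..u}|lborel. C * f r)"
    proof (rule L2_dist_bochner_integral_le[OF Au y y'])
      show "set_integrable lborel {0..u} (\<lambda>r. C * f r)"
        using u by (intro borel_integrable_atLeastAtMost' continuous_intros continuous_on_subset[OF cont]) auto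
      show "AE r in lborel. r \<in> {0..u} \<longrightarrow>
          L2_dist (T0 (u - r) (B b r (B b r (w r)))) (T0 (u - r) (B b r (B b r (z r)))) \<le> C * f r"
        using B_B_Lipschitz
      proof eventually_elim
        case (elim r)
        show ?case
        proof
          assume "r \<in> {0..u}"
          then have q: "sqint unit_measure (w r)" "sqint unit_measure (z r)" using wz by auto
          then have "L2_dist (T0 (u - r) (B b r (B b r (w r)))) (T0 (u - r) (B b r (B b r (z r))))
              = L2_dist (B b r (B b r (w r))) (B b r (B b r (z r)))"
            by (intro T0_isometric B_B_measurable sqint_measurable)
          then show "L2_dist (T0 (u - r) (B b r (B b r (w r)))) (T0 (u - r) (B b r (B b r (z r)))) \<le> C * f r"
            using elim q by (simp add: f_def)
        qed
      qed
    qed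
    finally show "f u \<le> (LINT r:{0..u}|lborel. C * f r)" .
  qed (use t C_nonneg in auto)
  then have "AE s in unit_measure. w t s - z t s = 0"
    by (intro norm2_eq_0_AE sqint_diff wz t) (simp add: f_def L2_dist_norm2)
  then show ?thesis by eventually_elim simp
qed

lemma well_posed_b: "well_posed b"
  unfolding well_posed_def
proof
  fix x assume "x \<in> L2_space"
  then have z: "mild_solution b x (propagated x)"
    by (intro mild_solution_propagated) (simp add: L2_space_sqint)
  then show "\<exists>z. mild_solution b x z \<and>
      (\<forall>w. mild_solution b x w \<longrightarrow> (\<forall>t\<ge>0. AE s in unit_measure. w t s = z t s))"
    using mild_solution_unique by (intro exI[of _ "propagated x"]) simp
qed

end

section \<open>Asymptotic behaviour\<close>

text \<open>
  From \<open>v \<le> exp v\<close> at \<open>v = u / (\<gamma> + 1)\<close>; dividing by \<open>\<gamma> + 1\<close> rather than by \<open>\<gamma>\<close> includes the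
  exponent \<open>\<gamma> = 0\<close>.
\<close>

lemma powr_le_exp:
  fixes \<gamma> u :: real
  assumes "0 \<le> \<gamma>" "0 \<le> u"
  shows "u powr \<gamma> \<le> (\<gamma> + 1) powr \<gamma> * exp u"
proof -
  have "u / (\<gamma> + 1) \<le> exp (u / (\<gamma> + 1))"
    using exp_ge_add_one_self[of "u / (\<gamma> + 1)"] by linarith
  then have "u \<le> (\<gamma> + 1) * exp (u / (\<gamma> + 1))" using assms by (simp add: field_simps)
  then have "u powr \<gamma> \<le> ((\<gamma> + 1) * exp (u / (\<gamma> + 1))) powr \<gamma>"
    using assms by (intro powr_mono2) auto
  also have "\<dots> = (\<gamma> + 1) powr \<gamma> * exp (u * (\<gamma> / (\<gamma> + 1)))"
    using assms by (simp add: powr_mult exp_powr_real)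
  also have "\<dots> \<le> (\<gamma> + 1) powr \<gamma> * exp (u * 1)"
  proof (rule mult_left_mono)
    have "u * (\<gamma> / (\<gamma> + 1)) \<le> u * 1" using assms by (intro mult_left_mono) auto
    then show "exp (u * (\<gamma> / (\<gamma> + 1))) \<le> exp (u * 1)" by (simp only: exp_le_cancel_iff)
  qed simp
  finally show ?thesis by simp
qed

context periodic_damping
begin

abbreviation "a \<equiv> damping b"

definition deviation :: "(real \<Rightarrow> complex) \<Rightarrow> (real \<Rightarrow> real \<Rightarrow> complex) \<Rightarrow> real \<Rightarrow> real" where
  "deviation x z t = L2_dist (z t) (T0 t (restrict_to (J_set a) x))"

lemma a_bounds: "AE s in unit_measure. s \<in> {0<..<1} \<and> a s = G 1 s \<and> 0 \<le> a s \<and> a s \<le> C"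
proof -
  have "AE s in unit_measure. s \<in> {0<..<1}"
    using AE_space[of unit_measure] by (simp add: space_restrict_space)
  with damping_eq_G show ?thesis
    by eventually_elim (use G_nonneg G_Lipschitz[of 0 1] in auto)
qed

lemma I_set_measurable [measurable]: "I_set a \<in> sets borel"
  and J_set_measurable [measurable]: "J_set a \<in> sets borel"
proof -
  note [measurable] = damping_measurable
  have "I_set a = {s. s \<in> {0<..<1} \<and> 0 < a s}" "J_set a = {s. s \<in> {0<..<1} \<and> a s = 0}"
    by (auto simp: I_set_def J_set_def)
  moreover have "{s. s \<in> {0<..<1} \<and> 0 < a s} \<in> sets borel" "{s. s \<in> {0<..<1} \<and> a s = 0} \<in> sets borel"
    by measurable
  ultimately show "I_set a \<in> sets borel" "J_set a \<in> sets borel" by simp_all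
qed

lemma unit_measurable_of_borel: "f \<in> borel_measurable borel \<Longrightarrow> f \<in> borel_measurable unit_measure"
  by (rule measurable_restrict_space1) simp

lemma restrict_to_J_sqint:
  assumes "sqint unit_measure x" shows "sqint unit_measure (restrict_to (J_set a) x)"
proof (rule sqint_bound_AE[OF assms, of _ 1])
  have [measurable]: "(indicator (J_set a) :: real \<Rightarrow> complex) \<in> borel_measurable unit_measure"
    by (rule unit_measurable_of_borel) measurable
  show "restrict_to (J_set a) x \<in> borel_measurable unit_measure"
    unfolding restrict_to_def using sqint_measurable[OF assms] by measurable
qed (auto simp: restrict_to_def split: split_indicator)

text \<open>
  The difference of the solution and its limit, rotated back by the time \<open>t\<close>.
\<close>

definition decaying :: "(real \<Rightarrow> complex) \<Rightarrow> real \<Rightarrow> real \<Rightarrow> complex" where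
  "decaying x t s = complex_of_real (indicator (I_set a) s * exp (- G t s)) * x s"

lemma decaying_measurable:
  assumes [measurable]: "x \<in> borel_measurable unit_measure"
  shows "decaying x t \<in> borel_measurable unit_measure"
proof -
  have [measurable]: "(\<lambda>s. indicator (I_set a) s * exp (- G t s)) \<in> borel_measurable unit_measure"
    by (rule unit_measurable_of_borel) measurable
  show ?thesis unfolding decaying_def[abs_def] by measurable
qed

text \<open>
  Both the solution and its limit are rotations by \<open>t\<close>, of \<open>exp (- G t) x\<close> and of \<open>1\<^sub>J x\<close>; on
  \<open>J\<close> these agree almost everywhere because \<open>0 \<le> G t \<le> (t + 1) a = 0\<close> there.
\<close>

lemma deviation_eq:
  assumes x: "sqint unit_measure x" and z: "mild_solution b x z" and t: "0 \<le> t"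
  shows "deviation x z t = norm2 unit_measure (decaying x t)"
proof -
  let ?y = "\<lambda>s. complex_of_real (exp (- G t s)) * x s"
  let ?j = "restrict_to (J_set a) x"
  note y = damped_propagator_sqint[OF x, of t] and j = restrict_to_J_sqint[OF x]
  have Tj: "sqint unit_measure (T0 t ?j)" using j by (simp add: sqint_T0_iff sqint_measurable)
  have "sqint unit_measure (z t)" using z t by (simp add: mild_solution_def L2_space_sqint)
  then have "deviation x z t = L2_dist (propagated x t) (T0 t ?j)"
    unfolding deviation_def L2_dist_norm2
  proof (intro norm2_cong_AE)
    show "AE s in unit_measure. z t s - T0 t ?j s = propagated x t s - T0 t ?j s"
      using mild_solution_unique[OF z mild_solution_propagated[OF x] t] by eventually_elim simp
  qed (auto intro!: sqint_measurable sqint_diff propagated_sqint x Tj)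
  also have "\<dots> = L2_dist ?y ?j"
    unfolding propagated_def by (intro T0_isometric sqint_measurable y j)
  also have "\<dots> = norm2 unit_measure (decaying x t)"
    unfolding L2_dist_norm2
  proof (rule norm2_cong_AE)
    show "AE s in unit_measure. ?y s - ?j s = decaying x t s"
      using a_bounds
    proof eventually_elim
      case (elim s)
      show ?case
      proof (cases "a s = 0")
        case True
        then have "G t s = 0" using G_linear_bounds(2)[OF t, of s] G_nonneg[of t s] elim by simp
        then show ?thesis using True elim by (simp add: restrict_to_def decaying_def I_set_def J_set_def)
      next
        case False
        then show ?thesis using elim by (simp add: restrict_to_def decaying_def I_set_def J_set_def)
      qed
    qed
  qed (auto intro!: sqint_measurable sqint_diff y j decaying_measurable x)
  finally show ?thesis .
qed

lemma decaying_le: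
  assumes "0 \<le> t" "a s = G 1 s"
  shows "cmod (decaying x t s) \<le> indicator (I_set a) s * exp (- ((t - 1) * a s)) * cmod (x s)"
proof -
  have "- G t s \<le> - ((t - 1) * a s)" using G_linear_bounds(1)[of t s] assms by simp
  then have "exp (- G t s) \<le> exp (- ((t - 1) * a s))" by (simp only: exp_le_cancel_iff)
  then show ?thesis
    by (cases "s \<in> I_set a") (simp_all add: decaying_def norm_mult mult_right_mono)
qed

lemma weighted_measurable:
  assumes [measurable]: "x \<in> borel_measurable unit_measure"
  shows "weighted a \<gamma> x \<in> borel_measurable unit_measure"
proof -
  note [measurable] = damping_measurable
  have [measurable]: "(\<lambda>s. indicator (I_set a) s * a s powr - \<gamma>) \<in> borel_measurable unit_measure"
    by (rule unit_measurable_of_borel) measurable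
  have eq: "weighted a \<gamma> x = (\<lambda>s. complex_of_real (indicator (I_set a) s * a s powr - \<gamma>) * x s)"
    by (auto simp: weighted_def fun_eq_iff)
  show ?thesis unfolding eq by measurable
qed

lemma weighted_0_sqint:
  assumes x: "sqint unit_measure x" shows "sqint unit_measure (weighted a 0 x)"
  by (rule sqint_bound_AE[OF x weighted_measurable[OF sqint_measurable[OF x]], where K = 1])
     (auto simp: weighted_def norm_mult)

lemma powr_exp_tendsto_0:
  fixes c \<gamma> :: real assumes "c > 0" shows "((\<lambda>t. t powr \<gamma> * exp (- ((t - 1) * c))) \<longlongrightarrow> 0) at_top"
  using assms by real_asymp

text \<open>
  Where \<open>a > 0\<close>, the function whose norm is taken is at most
  \<open>t\<^sup>\<gamma> exp (- (t - 1) a) \<bar>x\<bar> = (t a)\<^sup>\<gamma> exp (- t a) \<cdot> exp a \<cdot> a\<^sup>-\<^sup>\<gamma> \<bar>x\<bar>\<close>. The first product is bounded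
  uniformly in \<open>t\<close> and \<open>a\<close>, so \<open>a\<^sup>-\<^sup>\<gamma> x\<close> provides a majorant, and pointwise the expression tends to
  0. The exponent \<open>\<gamma> = 0\<close> is admitted, for which the hypothesis on the weighted function holds for
  every \<open>x\<close>: this is plain convergence.
\<close>

theorem deviation_powr_tendsto_0:
  assumes x: "sqint unit_measure x" and z: "mild_solution b x z"
    and \<gamma>: "0 \<le> \<gamma>" and w: "sqint unit_measure (weighted a \<gamma> x)"
  shows "((\<lambda>t. t powr \<gamma> * deviation x z t) \<longlongrightarrow> 0) at_top"
proof -
  note xm = sqint_measurable[OF x]
  define K where "K = (\<gamma> + 1) powr \<gamma> * exp C"
  let ?F = "\<lambda>t s. complex_of_real (t powr \<gamma>) * decaying x t s"
  note [measurable] = decaying_measurable[OF xm]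
  have bound: "cmod (?F t s) \<le> K * cmod (weighted a \<gamma> x s)"
    if t: "1 \<le> t" and s: "s \<in> {0<..<1}" "a s = G 1 s" "0 \<le> a s" "a s \<le> C" for t s
  proof (cases "s \<in> I_set a")
    case False
    then show ?thesis by (simp add: decaying_def weighted_def)
  next
    case True
    then have pos: "0 < a s" by (simp add: I_set_def)
    have "cmod (?F t s) \<le> t powr \<gamma> * (exp (- ((t - 1) * a s)) * cmod (x s))"
      using decaying_le[of t s x] t s True by (simp add: norm_mult mult_left_mono)
    also have "t powr \<gamma> * (exp (- ((t - 1) * a s)) * cmod (x s))
        = (t * a s) powr \<gamma> * a s powr - \<gamma> * (exp (- ((t - 1) * a s)) * cmod (x s))"
      using t pos by (simp add: powr_mult powr_minus)
    also have "\<dots> = ((t * a s) powr \<gamma> * exp (- (t * a s))) * exp (a s) * (a s powr - \<gamma> * cmod (x s))"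
      by (simp add: exp_add[symmetric] algebra_simps)
    also have "\<dots> \<le> (\<gamma> + 1) powr \<gamma> * exp C * (a s powr - \<gamma> * cmod (x s))"
    proof (intro mult_right_mono mult_mono)
      have "(t * a s) powr \<gamma> * exp (- (t * a s)) \<le> ((\<gamma> + 1) powr \<gamma> * exp (t * a s)) * exp (- (t * a s))"
        using powr_le_exp[OF \<gamma>, of "t * a s"] t pos by (intro mult_right_mono) auto
      also have "\<dots> = (\<gamma> + 1) powr \<gamma>" by (simp add: mult.assoc flip: exp_add)
      finally show "(t * a s) powr \<gamma> * exp (- (t * a s)) \<le> (\<gamma> + 1) powr \<gamma>" .
    qed (use s in auto)
    finally show ?thesis using True by (simp add: K_def weighted_def norm_mult)
  qed
  have "((\<lambda>t. LINT s|unit_measure. (cmod (?F t s))\<^sup>2) \<longlongrightarrow> (LINT s|unit_measure. (0::real))) at_top"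
  proof (rule integral_dominated_convergence_at_top)
    show "integrable unit_measure (\<lambda>s. K\<^sup>2 * (cmod (weighted a \<gamma> x s))\<^sup>2)"
      using w by (auto simp: sqint_def)
    show "\<forall>\<^sub>F t in at_top. AE s in unit_measure. norm ((cmod (?F t s))\<^sup>2) \<le> K\<^sup>2 * (cmod (weighted a \<gamma> x s))\<^sup>2"
      using eventually_ge_at_top[of 1]
    proof eventually_elim
      case t: (elim t)
      show ?case using a_bounds
      proof eventually_elim
        case (elim s)
        then have "(cmod (?F t s))\<^sup>2 \<le> (K * cmod (weighted a \<gamma> x s))\<^sup>2"
          using bound[OF t] by (intro power_mono) auto
        then show ?case by (simp add: power_mult_distrib)
      qed
    qed
    show "AE s in unit_measure. ((\<lambda>t. (cmod (?F t s))\<^sup>2) \<longlongrightarrow> 0) at_top"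
      using a_bounds
    proof eventually_elim
      case (elim s)
      have "((\<lambda>t. cmod (?F t s)) \<longlongrightarrow> 0) at_top"
      proof (cases "s \<in> I_set a")
        case True
        then have pos: "0 < a s" by (simp add: I_set_def)
        show ?thesis
        proof (rule tendsto_sandwich[OF always_eventually _ tendsto_const])
          show "\<forall>\<^sub>F t in at_top. cmod (?F t s) \<le> (t powr \<gamma> * exp (- ((t - 1) * a s))) * cmod (x s)"
            using eventually_ge_at_top[of 1]
            by eventually_elim
              (use decaying_le[of _ s x] elim True in \<open>simp add: norm_mult mult_left_mono mult.assoc\<close>)
          show "((\<lambda>t. (t powr \<gamma> * exp (- ((t - 1) * a s))) * cmod (x s)) \<longlongrightarrow> 0) at_top"
            by (rule tendsto_mult_left_zero[OF powr_exp_tendsto_0[OF pos]])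
        qed simp
      qed (simp add: decaying_def)
      from tendsto_power[OF this, of 2] show ?case by simp
    qed
  qed measurable
  then have "((\<lambda>t. norm2 unit_measure (?F t)) \<longlongrightarrow> sqrt 0) at_top"
    unfolding norm2_def by (intro tendsto_real_sqrt) simp
  then have lim: "((\<lambda>t. norm2 unit_measure (?F t)) \<longlongrightarrow> 0) at_top" by simp
  have "\<forall>\<^sub>F t in at_top. norm2 unit_measure (?F t) = t powr \<gamma> * deviation x z t"
    using eventually_ge_at_top[of 0]
    by eventually_elim (simp only: norm2_scale deviation_eq[OF x z], simp)
  then show ?thesis by (rule Lim_transform_eventually[OF lim])
qed

lemma deviation_tendsto_0:
  assumes x: "sqint unit_measure x" and z: "mild_solution b x z"
  shows "(deviation x z \<longlongrightarrow> 0) at_top"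
proof -
  have "\<forall>\<^sub>F t::real in at_top. t powr 0 * deviation x z t = deviation x z t"
    using eventually_gt_at_top[of 0] by eventually_elim simp
  then show ?thesis
    by (rule Lim_transform_eventually[OF deviation_powr_tendsto_0[OF x z order_refl weighted_0_sqint[OF x]]])
qed

lemma deviation_smallo:
  assumes x: "sqint unit_measure x" and z: "mild_solution b x z"
    and \<gamma>: "0 \<le> \<gamma>" and w: "sqint unit_measure (weighted a \<gamma> x)"
  shows "deviation x z \<in> o[at_top](\<lambda>t. t powr - \<gamma>)"
proof (rule smalloI_tendsto)
  have "\<forall>\<^sub>F t::real in at_top. t powr \<gamma> * deviation x z t = deviation x z t / t powr - \<gamma>"
    using eventually_gt_at_top[of 0] by eventually_elim (simp add: powr_minus field_simps)
  then show "((\<lambda>t. deviation x z t / t powr - \<gamma>) \<longlongrightarrow> 0) at_top"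
    using deviation_powr_tendsto_0[OF assms] by (rule Lim_transform_eventually[rotated])
  show "\<forall>\<^sub>F t::real in at_top. t powr - \<gamma> \<noteq> 0"
    using eventually_gt_at_top[of 0] by eventually_elim simp
qed

lemma T0_restrict_norm:
  assumes "sqint unit_measure x"
  shows "sqint unit_measure (T0 t (restrict_to (J_set a) x))"
    and "norm2 unit_measure (T0 t (restrict_to (J_set a) x)) = norm2 unit_measure (restrict_to (J_set a) x)"
  using restrict_to_J_sqint[OF assms] by (simp_all add: sqint_T0_iff norm2_T0 sqint_measurable)

lemma asymptotically_periodic_b: "asymptotically_periodic b"
  unfolding asymptotically_periodic_def
proof (intro ballI allI impI)
  fix x z assume "x \<in> L2_space" and z: "mild_solution b x z"
  then have x: "sqint unit_measure x" by (simp add: L2_space_sqint)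
  let ?z0 = "\<lambda>t. T0 t (restrict_to (J_set a) x)"
  show "\<exists>z0. (\<forall>t\<ge>0. z0 t \<in> L2_space) \<and> (\<exists>p>0. \<forall>t\<ge>0. AE s in unit_measure. z0 (t + p) s = z0 t s) \<and>
      ((\<lambda>t. L2_dist (z t) (z0 t)) \<longlongrightarrow> 0) at_top"
  proof (intro exI[of _ ?z0] conjI exI[of _ "1::real"])
    show "\<forall>t\<ge>0. ?z0 t \<in> L2_space" using T0_restrict_norm[OF x] by (simp add: L2_space_sqint)
    have "frac (s + (t + 1)) = frac (s + t)" for s t :: real
      using frac_1_eq[of "s + t"] by (simp add: add.assoc)
    then show "\<forall>t\<ge>0. AE s in unit_measure. ?z0 (t + 1) s = ?z0 t s"
      by (auto simp: T0_def per_ext_def simp del: frac_eq_0_iff)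
    show "((\<lambda>t. L2_dist (z t) (?z0 t)) \<longlongrightarrow> 0) at_top"
      using deviation_tendsto_0[OF x z] by (simp add: deviation_def[abs_def])
  qed simp
qed

text \<open>
  The limit \<open>T0 t (1\<^sub>J x)\<close> has constant norm \<open>\<parallel>1\<^sub>J x\<parallel>\<close>, which vanishes for all \<open>x\<close> if \<open>J\<close> is
  null; conversely \<open>x = 1\<close> is a test function that detects \<open>J\<close>.
\<close>

lemma is_stable_iff: "is_stable b \<longleftrightarrow> J_set a \<in> null_sets lborel"
proof
  assume stable: "is_stable b"
  let ?x = "\<lambda>s::real. 1 :: complex"
  have x: "sqint unit_measure ?x" by (rule sqint_bounded[OF finite_measure_unit, of _ 1]) auto
  note z = mild_solution_propagated[OF x]
  let ?j = "restrict_to (J_set a) ?x"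
  have le: "norm2 unit_measure ?j \<le> L2_norm (propagated ?x t) + deviation ?x (propagated ?x) t" for t
  proof -
    note T = T0_restrict_norm[OF x, of t]
    have "norm2 unit_measure (\<lambda>s. T0 t ?j s - 0)
        \<le> norm2 unit_measure (\<lambda>s. T0 t ?j s - propagated ?x t s) + norm2 unit_measure (\<lambda>s. propagated ?x t s - 0)"
      by (rule norm2_triangle_diff[OF T(1) propagated_sqint[OF x] sqint_zero])
    then show ?thesis
      using T(2) norm2_minus_commute[of unit_measure "T0 t ?j" "propagated ?x t"]
      by (simp add: deviation_def L2_dist_norm2 L2_norm_norm2)
  qed
  have lim: "((\<lambda>t. L2_norm (propagated ?x t) + deviation ?x (propagated ?x) t) \<longlongrightarrow> 0 + 0) at_top"
    using stable z x deviation_tendsto_0[OF x z] by (intro tendsto_add) (auto simp: is_stable_def L2_space_sqint)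
  have "norm2 unit_measure ?j \<le> 0 + 0"
    by (rule tendsto_lowerbound[OF lim always_eventually]) (use le in auto)
  then have "AE s in unit_measure. ?j s = 0"
    by (intro norm2_eq_0_AE restrict_to_J_sqint[OF x]) (simp add: antisym)
  then have "AE s in lborel. s \<notin> J_set a"
    by (auto simp: AE_restrict_space_iff restrict_to_def J_set_def elim!: eventually_mono split: split_indicator_asm)
  then show "J_set a \<in> null_sets lborel" by (subst AE_iff_null_sets) auto
next
  assume "J_set a \<in> null_sets lborel"
  then have J: "AE s in lborel. s \<notin> J_set a" by (rule AE_not_in)
  show "is_stable b"
    unfolding is_stable_def
  proof (intro ballI allI impI)
    fix x z assume "x \<in> L2_space" and z: "mild_solution b x z"
    then have x: "sqint unit_measure x" by (simp add: L2_space_sqint)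
    have "AE s in unit_measure. restrict_to (J_set a) x s = 0"
      using J by (auto simp: AE_restrict_space_iff restrict_to_def elim!: eventually_mono)
    then have "norm2 unit_measure (restrict_to (J_set a) x) = norm2 unit_measure (\<lambda>s. 0)"
      using restrict_to_J_sqint[OF x] by (intro norm2_cong_AE) (auto simp: sqint_def)
    then have j: "norm2 unit_measure (T0 t (restrict_to (J_set a) x)) = 0" for t
      using T0_restrict_norm(2)[OF x] by (simp add: norm2_def)
    show "((\<lambda>t. L2_norm (z t)) \<longlongrightarrow> 0) at_top"
    proof (rule tendsto_sandwich[OF always_eventually _ tendsto_const deviation_tendsto_0[OF x z]])
      show "\<forall>\<^sub>F t in at_top. L2_norm (z t) \<le> deviation x z t"
        using eventually_ge_at_top[of 0]
      proof eventually_elim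
        case (elim t)
        then have zt: "sqint unit_measure (z t)" using z by (simp add: mild_solution_def L2_space_sqint)
        from norm2_triangle_diff[OF zt T0_restrict_norm(1)[OF x] sqint_zero, of t]
        show ?case by (simp add: j deviation_def L2_dist_norm2 L2_norm_norm2)
      qed
    qed (simp add: L2_norm_norm2)
  qed
qed

text \<open>
  If \<open>a \<ge> c\<close> on \<open>I\<close> then \<open>G t \<ge> c (t - 1)\<close> there; for \<open>t < 1\<close> the right-hand side is negative.
\<close>

lemma exponential_decay:
  assumes c: "0 < c" and ac: "AE s in lborel. s \<in> I_set a \<longrightarrow> c \<le> a s"
    and x: "sqint unit_measure x" and z: "mild_solution b x z" and t: "0 \<le> t"
  shows "deviation x z t \<le> exp c * exp (- c * t) * norm2 unit_measure x"
  unfolding deviation_eq[OF x z t]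
proof (rule norm2_mono_AE[OF x decaying_measurable[OF sqint_measurable[OF x]]])
  have "AE s in unit_measure. s \<in> I_set a \<longrightarrow> c \<le> a s"
    using ac by (auto simp: AE_restrict_space_iff elim: eventually_mono)
  then show "AE s in unit_measure. cmod (decaying x t s) \<le> exp c * exp (- c * t) * cmod (x s)"
    using a_bounds
  proof eventually_elim
    case (elim s)
    show ?case
    proof (cases "s \<in> I_set a")
      case True
      have "c * (t - 1) \<le> G t s"
      proof (cases "1 \<le> t")
        case True
        then have "c * (t - 1) \<le> (t - 1) * G 1 s"
          using mult_left_mono[of c "G 1 s" "t - 1"] elim \<open>s \<in> I_set a\<close> by (simp add: mult.commute)
        then show ?thesis using G_linear_bounds(1)[OF t, of s] by simp
      next
        case False
        then have "c * (t - 1) \<le> 0" using c by (simp add: mult_le_0_iff)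
        then show ?thesis using G_nonneg[of t s] by simp
      qed
      then have "exp (- G t s) \<le> exp c * exp (- c * t)" by (simp add: algebra_simps flip: exp_add)
      then show ?thesis using True by (simp add: decaying_def norm_mult mult_right_mono)
    qed (simp add: decaying_def)
  qed
qed simp

text \<open>
  Were \<open>S = {0 < a < \<beta>/2}\<close> of positive measure, the solution starting from \<open>1\<^sub>S\<close> would
  decay no faster than \<open>exp (- (t + 1) \<beta>/2)\<close>, which is eventually larger than any multiple of
  \<open>exp (- \<beta> t)\<close>.
\<close>

lemma damping_gap_if_exponential_decay:
  assumes M: "0 < M" and \<beta>: "0 < \<beta>"
    and decay: "\<And>t x z. 0 \<le> t \<Longrightarrow> sqint unit_measure x \<Longrightarrow> mild_solution b x z \<Longrightarrow>
      deviation x z t \<le> M * exp (- \<beta> * t) * norm2 unit_measure x"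
  shows "AE s in lborel. s \<in> I_set a \<longrightarrow> \<beta> / 2 \<le> a s"
proof -
  note [measurable] = damping_measurable
  define c where "c = \<beta> / 2"
  have c: "0 < c" and \<beta>c: "\<beta> = c + c" using \<beta> by (auto simp: c_def)
  define S where "S = I_set a \<inter> {s. a s < c}"
  have [measurable]: "S \<in> sets borel" unfolding S_def by measurable
  let ?x = "indicator S :: real \<Rightarrow> complex"
  have xm: "?x \<in> borel_measurable unit_measure" by (rule unit_measurable_of_borel) measurable
  have x: "sqint unit_measure ?x"
    by (rule sqint_bounded[OF finite_measure_unit xm, of 1]) (auto split: split_indicator)
  note z = mild_solution_propagated[OF x]
  have "norm2 unit_measure ?x \<le> M * exp (c - c * t) * norm2 unit_measure ?x" if t: "0 \<le> t" for t
  proof -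
    have dec: "sqint unit_measure (decaying ?x t)"
      by (rule sqint_bound_AE[OF x decaying_measurable[OF xm], where K = 1])
         (auto simp: decaying_def norm_mult G_nonneg split: split_indicator)
    have "norm2 unit_measure ?x \<le> exp (c * (t + 1)) * norm2 unit_measure (decaying ?x t)"
    proof (rule norm2_mono_AE[OF dec xm])
      show "AE s in unit_measure. cmod (?x s) \<le> exp (c * (t + 1)) * cmod (decaying ?x t s)"
        using a_bounds
      proof eventually_elim
        case (elim s)
        show ?case
        proof (cases "s \<in> S")
          case True
          then have "G 1 s \<le> c" using elim by (simp add: S_def)
          then have "(t + 1) * G 1 s \<le> c * (t + 1)" using t by (simp add: mult.commute mult_left_mono)
          then have "G t s \<le> c * (t + 1)" using G_linear_bounds(2)[OF t, of s] by simp
          then have "1 \<le> exp (c * (t + 1)) * exp (- G t s)" by (simp flip: exp_add)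
          then show ?thesis using True by (simp add: decaying_def norm_mult S_def)
        qed simp
      qed
    qed simp
    also have "\<dots> \<le> exp (c * (t + 1)) * (M * exp (- \<beta> * t) * norm2 unit_measure ?x)"
      using decay[OF t x z] by (simp add: deviation_eq[OF x z t])
    also have "\<dots> = M * (exp (c * (t + 1)) * exp (- \<beta> * t)) * norm2 unit_measure ?x" by simp
    also have "exp (c * (t + 1)) * exp (- \<beta> * t) = exp (c - c * t)"
      unfolding exp_add[symmetric] \<beta>c by (simp add: algebra_simps)
    finally show ?thesis .
  qed
  then have "\<forall>\<^sub>F t in at_top. norm2 unit_measure ?x \<le> M * exp (c - c * t) * norm2 unit_measure ?x"
    by (rule eventually_mono[OF eventually_ge_at_top])
  moreover have "((\<lambda>t. M * exp (c - c * t)) \<longlongrightarrow> 0) at_top" using c by real_asymp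
  then have "((\<lambda>t. M * exp (c - c * t) * norm2 unit_measure ?x) \<longlongrightarrow> 0) at_top" by (rule tendsto_mult_left_zero)
  ultimately have "norm2 unit_measure ?x \<le> 0"
    by (intro tendsto_le[OF _ _ tendsto_const]) auto
  then have "AE s in unit_measure. ?x s = 0" by (intro norm2_eq_0_AE x) (simp add: antisym)
  then show ?thesis
    by (auto simp: AE_restrict_space_iff S_def c_def I_set_def elim!: eventually_mono split: split_indicator_asm)
qed

text \<open>
  Cutting \<open>y\<close> off where \<open>0 < a < 1/(n + 1)\<close> leaves a function on which every negative power of \<open>a\<close> is
  bounded, and it converges to \<open>y\<close> by dominated convergence.
\<close>

lemma rapid_subspace_dense: "L2_dense_subspace (rapid_subspace a)"
  unfolding L2_dense_subspace_def
proof (intro conjI ballI allI impI)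
  have rap: "x \<in> rapid_subspace a \<longleftrightarrow> sqint unit_measure x \<and> (\<forall>k\<ge>1. sqint unit_measure (weighted a (real k) x))" for x
    by (auto simp: rapid_subspace_def L2_space_sqint)
  show "rapid_subspace a \<subseteq> L2_space" by (auto simp: rapid_subspace_def)
  have "weighted a \<gamma> (\<lambda>s. 0) = (\<lambda>s. 0)" for \<gamma> by (auto simp: weighted_def)
  then show "(\<lambda>s. 0) \<in> rapid_subspace a" by (simp add: rap)
  have "weighted a \<gamma> (\<lambda>s. x s + y s) = (\<lambda>s. weighted a \<gamma> x s + weighted a \<gamma> y s)" for \<gamma> x y
    by (auto simp: weighted_def algebra_simps)
  then show "(\<lambda>s. x s + y s) \<in> rapid_subspace a" if "x \<in> rapid_subspace a" "y \<in> rapid_subspace a" for x y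
    using that by (simp add: rap sqint_add)
  have "weighted a \<gamma> (\<lambda>s. c * x s) = (\<lambda>s. c * weighted a \<gamma> x s)" for \<gamma> x c
    by (auto simp: weighted_def)
  then show "(\<lambda>s. c * x s) \<in> rapid_subspace a" if "x \<in> rapid_subspace a" for x c
    using that by (simp add: rap sqint_scale)
  fix y \<epsilon> assume "y \<in> L2_space" and \<epsilon>: "(0::real) < \<epsilon>"
  then have y: "sqint unit_measure y" by (simp add: L2_space_sqint)
  have [measurable]: "y \<in> borel_measurable unit_measure" using y by (rule sqint_measurable)
  let ?c = "\<lambda>n. inverse (real (Suc n))"
  let ?x = "\<lambda>n s. (if s \<in> I_set a \<and> a s < ?c n then 0 else y s)"
  have xm: "?x n \<in> borel_measurable unit_measure" for n
  proof -
    note [measurable] = damping_measurable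
    have [measurable]: "(\<lambda>s. indicator (I_set a \<inter> {s. a s < ?c n}) s :: complex) \<in> borel_measurable unit_measure"
      by (rule unit_measurable_of_borel) measurable
    have eq: "?x n = (\<lambda>s. (1 - indicator (I_set a \<inter> {s. a s < ?c n}) s) * y s)"
      by (auto simp: fun_eq_iff split: split_indicator)
    show ?thesis unfolding eq by measurable
  qed
  have xs: "sqint unit_measure (?x n)" for n
    by (rule sqint_bound_AE[OF y xm, of _ 1]) auto
  have "?x n \<in> rapid_subspace a" for n
    unfolding rap
  proof (intro conjI allI impI xs)
    fix k :: nat assume "1 \<le> k"
    show "sqint unit_measure (weighted a (real k) (?x n))"
    proof (rule sqint_bound_AE[OF y weighted_measurable[OF xm], of _ _ "?c n powr - real k"])
      have "a s powr - real k \<le> ?c n powr - real k" if "?c n \<le> a s" for s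
        using that by (intro powr_mono2') auto
      then show "AE s in unit_measure. cmod (weighted a (real k) (?x n) s) \<le> ?c n powr - real k * cmod (y s)"
        by (intro AE_I2) (simp add: weighted_def norm_mult mult_right_mono)
    qed
  qed
  moreover have "(\<lambda>n. norm2 unit_measure (\<lambda>s. ?x n s - y s)) \<longlonglongrightarrow> 0"
  proof (rule tendsto_norm2_dominated[OF y xm, where K = 1])
    have "(\<lambda>n. ?x n s) \<longlonglongrightarrow> y s" for s
    proof (rule tendsto_eventually)
      show "\<forall>\<^sub>F n in sequentially. ?x n s = y s"
      proof (cases "s \<in> I_set a")
        case True
        then have "\<forall>\<^sub>F n in sequentially. ?c n < a s"
          using order_tendstoD(2)[OF LIMSEQ_inverse_real_of_nat, of "a s"] by (simp add: I_set_def)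
        then show ?thesis by eventually_elim auto
      qed simp
    qed
    then show "AE s in unit_measure. (\<lambda>n. ?x n s) \<longlonglongrightarrow> y s" by simp
  qed auto
  then have "\<forall>\<^sub>F n in sequentially. L2_dist (?x n) y < \<epsilon>"
    unfolding L2_dist_norm2 using \<epsilon> by (rule order_tendstoD(2))
  then obtain n where "L2_dist (?x n) y < \<epsilon>" by (auto simp: eventually_sequentially)
  ultimately show "\<exists>x\<in>rapid_subspace a. L2_dist x y < \<epsilon>" by blast
qed

lemma deviation_superpolynomial:
  assumes x: "x \<in> rapid_subspace a" and z: "mild_solution b x z" and \<gamma>: "0 < \<gamma>"
  shows "deviation x z \<in> o[at_top](\<lambda>t. t powr - \<gamma>)"
proof -
  define k where "k = nat \<lceil>max 1 \<gamma>\<rceil>"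
  have k: "1 \<le> k" "\<gamma> \<le> real k" unfolding k_def by linarith+
  have "sqint unit_measure x" "sqint unit_measure (weighted a (real k) x)"
    using x k(1) by (auto simp: rapid_subspace_def L2_space_sqint)
  from deviation_smallo[OF this(1) z _ this(2)]
  have "deviation x z \<in> o[at_top](\<lambda>t. t powr - real k)" by simp
  also have "(\<lambda>t::real. t powr - real k) \<in> O[at_top](\<lambda>t. t powr - \<gamma>)"
  proof (rule bigoI[of _ 1])
    show "\<forall>\<^sub>F t::real in at_top. norm (t powr - real k) \<le> 1 * norm (t powr - \<gamma>)"
      using eventually_ge_at_top[of 1] by eventually_elim (use k in \<open>simp add: powr_mono\<close>)
  qed
  finally show ?thesis .
qed

end

theorem theorem4p1:
  fixes b :: "real \<Rightarrow> real \<Rightarrow> real" and a :: "real \<Rightarrow> real"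
    and err :: "(real \<Rightarrow> complex) \<Rightarrow> (real \<Rightarrow> real \<Rightarrow> complex) \<Rightarrow> real \<Rightarrow> real"
  assumes bounded: "Linfty b"
    and nonneg: "AE (s, t) in \<Omega>_measure. b s t \<ge> 0"
    and periodic: "AE (s, t) in \<Omega>_measure. b s (t + 1) = b s t"
  defines "a \<equiv> damping b"
    and "err \<equiv> \<lambda>x z t. L2_dist (z t) (T0 t (restrict_to (J_set a) x))"
  shows
    "well_posed b \<and>
     ((\<forall>x\<in>L2_space. \<forall>z. mild_solution b x z \<longrightarrow> (err x z \<longlongrightarrow> 0) at_top) \<and>
      asymptotically_periodic b \<and>
      (is_stable b \<longleftrightarrow> J_set a \<in> null_sets lborel)) \<and>
     ((\<exists>M>0. \<exists>\<beta>>0. \<forall>t\<ge>0. \<forall>x\<in>L2_space. \<forall>z. mild_solution b x z \<longrightarrow>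
         err x z t \<le> M * exp (- \<beta> * t) * L2_norm x)
      \<longleftrightarrow> (\<exists>c>0. AE s in lborel. s \<in> I_set a \<longrightarrow> a s \<ge> c)) \<and>
     (\<forall>x\<in>L2_space. \<forall>z. mild_solution b x z \<longrightarrow>
        (\<forall>\<gamma>>0. weighted a \<gamma> x \<in> L2_space \<longrightarrow> err x z \<in> o[at_top](\<lambda>t. t powr (-\<gamma>)))) \<and>
     (L2_dense_subspace (rapid_subspace a) \<and>
      (\<forall>x\<in>rapid_subspace a. \<forall>z. mild_solution b x z \<longrightarrow>
        (\<forall>\<gamma>>0. err x z \<in> o[at_top](\<lambda>t. t powr (-\<gamma>)))))"
proof -
  obtain C where C: "AE (s, t) in \<Omega>_measure. \<bar>b s t\<bar> \<le> C"
    and m: "(\<lambda>(s, t). b s t) \<in> borel_measurable \<Omega>_measure"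
    using bounded by (auto simp: Linfty_def)
  interpret D: periodic_damping b "\<bar>C\<bar>"
  proof
    show "AE (s, t) in \<Omega>_measure. 0 \<le> b s t \<and> b s t \<le> \<bar>C\<bar>"
      using C nonneg by eventually_elim auto
  qed (use m periodic in auto)
  have err: "err = D.deviation"
    by (intro ext) (simp add: err_def a_def D.deviation_def)
  have ii: "(\<exists>M>0. \<exists>\<beta>>0. \<forall>t\<ge>0. \<forall>x\<in>L2_space. \<forall>z. mild_solution b x z \<longrightarrow>
         err x z t \<le> M * exp (- \<beta> * t) * L2_norm x)
      \<longleftrightarrow> (\<exists>c>0. AE s in lborel. s \<in> I_set a \<longrightarrow> a s \<ge> c)"
  proof
    assume "\<exists>M>0. \<exists>\<beta>>0. \<forall>t\<ge>0. \<forall>x\<in>L2_space. \<forall>z. mild_solution b x z \<longrightarrow>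
         err x z t \<le> M * exp (- \<beta> * t) * L2_norm x"
    then obtain M \<beta> where M: "M > 0" and \<beta>: "\<beta> > 0" and decay: "\<forall>t\<ge>0. \<forall>x\<in>L2_space. \<forall>z. mild_solution b x z \<longrightarrow>
         err x z t \<le> M * exp (- \<beta> * t) * L2_norm x" by blast
    from decay have "\<And>t x z. 0 \<le> t \<Longrightarrow> sqint unit_measure x \<Longrightarrow> mild_solution b x z \<Longrightarrow>
        D.deviation x z t \<le> M * exp (- \<beta> * t) * norm2 unit_measure x"
      unfolding err L2_norm_norm2 L2_space_sqint[symmetric] by blast
    from D.damping_gap_if_exponential_decay[OF M \<beta> this]
    show "\<exists>c>0. AE s in lborel. s \<in> I_set a \<longrightarrow> a s \<ge> c"
      using \<beta> unfolding a_def by (intro exI[of _ "\<beta> / 2"]) auto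
  next
    assume "\<exists>c>0. AE s in lborel. s \<in> I_set a \<longrightarrow> a s \<ge> c"
    then obtain c where "c > 0" "AE s in lborel. s \<in> I_set (damping b) \<longrightarrow> c \<le> damping b s"
      unfolding a_def by blast
    from D.exponential_decay[OF this] \<open>c > 0\<close>
    show "\<exists>M>0. \<exists>\<beta>>0. \<forall>t\<ge>0. \<forall>x\<in>L2_space. \<forall>z. mild_solution b x z \<longrightarrow>
         err x z t \<le> M * exp (- \<beta> * t) * L2_norm x"
      unfolding err L2_norm_norm2
      by (rule_tac exI[of _ "exp c"], rule_tac conjI, simp, rule_tac exI[of _ c]) (auto simp: L2_space_sqint)
  qed
  show ?thesis
    unfolding ii unfolding err a_def
    by (intro conjI ballI allI impI)
       (auto simp: L2_space_sqint D.is_stable_iff intro: D.well_posed_b D.deviation_tendsto_0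
          D.asymptotically_periodic_b D.deviation_smallo D.rapid_subspace_dense D.deviation_superpolynomial)
qed

end
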